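(* Let $R$ be a finite commutative local ring. Let $\xi$ be an $R$-valued random variable whose distribution is not concentrated on a translate of a proper ideal of $R$ and is not concentrated on a translate of a proper subring of $R$. Let $u\in\mathbb Z$ and, for $n\geq 1$ with $n+u\ge 1$, let $\mathcal M_{n,n+u}$ be a random $n\times(n+u)$ matrix whose entries are i.i.d. with the distribution of $\xi$. Let $\mathbf v_1$ be a random vector in $R^n$ whose entries are i.i.d. with the distribution of $\xi$, and let $\mathbf v_0$ be a uniformly distributed random element of $R^n$. Then there exists $\theta<1$, depending on $R$ and on the distribution of $\xi$, such that $$\sum_{X}\mathbb P(\mathcal M_{n,n+u}=X)\; d_{TV}\big(\mathbf v_1+\operatorname{im}(X),\ \mathbf v_0+\operatorname{im}(X)\big)\le O(\theta^n),$$ where the sum is over all $n\times(n+u)$ matrices $X$ over $R$. Moreover, the same estimate continues to hold if some of the entries of $\mathcal M_{n,n+u}$ (any subset of the entries) are replaced by independent random variables uniformly distributed on $R$.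
   Context: For a matrix $X$ with $n$ rows, $\operatorname{im}(X)\subset R^n$ is the submodule spanned by its columns. For a submodule $B\subset R^n$ and a random element $\mathbf v$ of $R^n$, $\mathbf v+B$ denotes the random element of $R^n$ obtained as the sum of $\mathbf v$ and an independent uniformly distributed random element of $B$. $d_{TV}$ is the total variation distance between the distributions of two random elements. The $O(\theta^n)$ is as $n\to\infty$ with $u$, $R$ and the distribution of $\xi$ fixed.
   Formalization: "Translate of a proper subring" is read as b+aS with a any unit of R, not only b+S: with b+S alone the claim fails, e.g. R=F_4, ξ uniform on {0,w} with w outside F_2, u=-1, where every distance is at least 1/2. *)

theory Defs
  imports
    "HOL-Probability.Probability"
    "HOL-Library.Landau_Symbols"
    "HOL-Algebra.Ideal"
    "HOL-Algebra.Subrings"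
    "Jordan_Normal_Form.VS_Connect"
begin

text \<open>
  The ring is a type of class \<open>comm_ring_1\<close>; \<open>class_ring\<close> is this type as a ring in the sense of
  HOL-Algebra, whose ideals, maximal ideals and (unital) subrings are used. Random elements of
  finite sets are represented by their distributions, as probability mass functions.
\<close>

definition local_ring :: "'a::comm_ring_1 itself \<Rightarrow> bool" where
  "local_ring _ \<longleftrightarrow> (\<exists>!\<mm>. maximalideal \<mm> (class_ring :: 'a ring))"

definition not_on_ideal_translate :: "'a::comm_ring_1 pmf \<Rightarrow> bool" where
  "not_on_ideal_translate \<mu> \<longleftrightarrow>
     (\<forall>I b. ideal I (class_ring :: 'a ring) \<and> I \<noteq> UNIV \<longrightarrow>
        measure_pmf.prob \<mu> ((\<lambda>x. b + x) ` I) \<noteq> 1)"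

text \<open>
  The translates of a subring \<open>S\<close> are its images under the invertible affine maps of the ring, that
  is the sets \<open>b + a S\<close> with \<open>a\<close> a unit. The unit factor is needed: multiplying all entries by a
  unit affects neither column spans nor uniformity, so a distribution on \<open>a S\<close> behaves like one on
  \<open>S\<close>, even when \<open>a S\<close> lies in no set \<open>b + S'\<close> with \<open>S'\<close> a proper subring (take the field with 4
  elements, \<open>S\<close> its prime field and \<open>a\<close> outside \<open>S\<close>). For ideals \<open>I\<close> the factor is immaterial since
  \<open>a I = I\<close>.
\<close>

definition not_on_subring_translate :: "'a::comm_ring_1 pmf \<Rightarrow> bool" where
  "not_on_subring_translate \<mu> \<longleftrightarrow>
     (\<forall>S a b. subring S (class_ring :: 'a ring) \<and> S \<noteq> UNIV \<and> a dvd 1 \<longrightarrow>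
        measure_pmf.prob \<mu> ((\<lambda>x. b + a * x) ` S) \<noteq> 1)"

definition column_im :: "'a::comm_ring_1 mat \<Rightarrow> 'a vec set" where
  "column_im X =
     LinearCombinations.module.span (class_ring :: 'a ring)
       (module_vec TYPE('a) (dim_row X)) (set (cols X))"

definition tv_dist :: "'b pmf \<Rightarrow> 'b pmf \<Rightarrow> real" where
  "tv_dist p q = (SUP A. \<bar>measure_pmf.prob p A - measure_pmf.prob q A\<bar>)"

definition plus_uniform :: "'a::comm_ring_1 vec pmf \<Rightarrow> 'a vec set \<Rightarrow> 'a vec pmf" where
  "plus_uniform v B = map_pmf (\<lambda>(x, y). x + y) (pair_pmf v (pmf_of_set B))"

definition iid_vec :: "nat \<Rightarrow> 'a::comm_ring_1 pmf \<Rightarrow> 'a vec pmf" where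
  "iid_vec n \<mu> = map_pmf (\<lambda>f. vec n f) (Pi_pmf {..<n} 0 (\<lambda>_. \<mu>))"

text \<open>
  The law of an \<open>n \<times> m\<close> matrix with independent entries, those at positions in \<open>E\<close> being uniform
  and all others having law \<open>\<mu>\<close>.
\<close>

definition random_mat ::
  "nat \<Rightarrow> nat \<Rightarrow> 'a::{finite, comm_ring_1} pmf \<Rightarrow> (nat \<times> nat) set \<Rightarrow> 'a mat pmf" where
  "random_mat n m \<mu> E =
     map_pmf (\<lambda>f. mat n m f)
       (Pi_pmf ({..<n} \<times> {..<m}) 0 (\<lambda>ij. if ij \<in> E then pmf_of_set UNIV else \<mu>))"

definition mean_tv ::
  "nat \<Rightarrow> nat \<Rightarrow> 'a::{finite, comm_ring_1} pmf \<Rightarrow> (nat \<times> nat) set \<Rightarrow> real" where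
  "mean_tv n m \<mu> E =
     (\<Sum>X\<in>carrier_mat n m. pmf (random_mat n m \<mu> E) X *
        tv_dist (plus_uniform (iid_vec n \<mu>) (column_im X))
                (plus_uniform (pmf_of_set (carrier_vec n)) (column_im X)))"

end

theory Submission
  imports Defs
begin

text \<open>
  The mean distance is bounded by a sum over the characters of the group of vectors, and the
  hypotheses on the law \<open>\<mu>\<close> enter through a single inequality about characters of the ring.

  Let \<open>q\<close> be the cardinality of the ring. A character \<open>w\<close> of the vectors of length \<open>n\<close> is a tuple of
  \<open>n\<close> additive characters of the ring. After adding a uniform element of a subgroup \<open>B\<close>, a law differs
  from the uniform law only through its Fourier coefficients at the nontrivial characters that are
  trivial on \<open>B\<close> (\<open>tv_plus_uniform_le\<close>). Averaging over the matrix, \<open>w\<close> contributes the absolute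
  value of its Fourier coefficient times the probability that it is trivial on the image. Whether
  \<open>w\<close> is trivial on the multiples of a column is detected by the mean over \<open>r\<close> of the value of \<open>w\<close> at
  \<open>r\<close> times the column, so by independence this probability is at most a product over the columns
  of means over \<open>r\<close> of products over the entries (\<open>mean_tv_le\<close>). A character that is not constant on the
  support of \<open>\<mu>\<close> has expectation at most \<open>\<rho> < 1\<close> in absolute value, for entries with law \<open>\<mu>\<close> and for
  uniform ones alike (\<open>uniform_char_mean_gap\<close>). With \<open>d r\<close> the number of coordinates \<open>i\<close> for which
  \<open>\<lambda>x. w i (r * x)\<close> is not constant on the support, it remains to sum
  \<open>\<rho> ^ d 1 * ((\<Sum>r\<in>UNIV. \<rho> ^ d r) / q) ^ m\<close> over all nontrivial \<open>w\<close>. This no longer depends on which entries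
  are uniform.

  For given \<open>w\<close> let \<open>N\<close> be the set of those \<open>r\<close> for which \<open>d r\<close> is a small proportion of \<open>n\<close>; the scale
  can be chosen such that \<open>d r\<close> is much larger for all other \<open>r\<close>. A column then contributes about
  \<open>card N / q\<close>. Up to a small proportion of the coordinates, \<open>w\<close> takes values in the group \<open>L\<close> of the
  characters \<open>f\<close> such that \<open>\<lambda>x. f (r * x)\<close> is constant on the support for all \<open>r \<in> N\<close>, so there are about
  \<open>card L ^ n\<close> such \<open>w\<close>. As \<open>m\<close> differs from \<open>n\<close> by a constant, everything depends on the size of
  \<open>card L * card N / q\<close>. It is at most 1, and it can be 1 only if \<open>1 \<notin> N\<close> or \<open>N = UNIV\<close>
  (\<open>stable_chars_card\<close>): this follows from the ring being local and \<open>\<mu>\<close> not being concentrated on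
  translates of proper ideals and subrings. If it is less than 1, the sum over these \<open>w\<close> decays exponentially. If
  \<open>1 \<notin> N\<close>, the factor \<open>\<rho> ^ d 1\<close> does. If \<open>N = UNIV\<close> and the value is 1, then \<open>L\<close> is trivial; these \<open>w\<close>
  have few nontrivial coordinates but at least one, which decreases the factor of each
  column by a constant.
\<close>

section \<open>Extending characters of finite abelian groups\<close>

definition character_on :: "('g, 'm) monoid_scheme \<Rightarrow> 'g set \<Rightarrow> ('g \<Rightarrow> complex) \<Rightarrow> bool" where
  "character_on G A c \<longleftrightarrow> c \<one>\<^bsub>G\<^esub> = 1 \<and> (\<forall>a\<in>A. \<forall>b\<in>A. c (a \<otimes>\<^bsub>G\<^esub> b) = c a * c b)"

context comm_group
begin

lemma subgroup_nat_pow_closed: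
  assumes "subgroup A G" "a \<in> A"
  shows "a [^] (j::nat) \<in> A"
  by (induction j) (use assms in \<open>auto intro: subgroup.m_closed subgroup.one_closed\<close>)

lemma character_on_pow:
  assumes "subgroup A G" "character_on G A c" "a \<in> A"
  shows "c (a [^] (j::nat)) = c a ^ j"
  by (induction j)
     (use assms subgroup_nat_pow_closed[OF assms(1,3)] in \<open>auto simp: character_on_def\<close>)

text \<open>
  A character \<open>c\<close> of \<open>A\<close> extends to the subgroup generated by \<open>A\<close> and \<open>x\<close> by giving \<open>x\<close> any value
  compatible with the only relation between \<open>x\<close> and \<open>A\<close>, which is that \<open>x\<close> to the power \<open>k\<close> lies
  in \<open>A\<close>: every power of \<open>x\<close> in \<open>A\<close> is a power of this one, so \<open>c a * z ^ j\<close> depends only on the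
  element \<open>a\<close> times \<open>x\<close> to the power \<open>j\<close>.
\<close>

lemma character_extend_by_element:
  assumes A: "subgroup A G" and c: "character_on G A c"
    and x: "x \<in> carrier G" and k: "k > 0" "x [^] (k::nat) \<in> A"
    and least: "\<And>j. 0 < j \<Longrightarrow> j < k \<Longrightarrow> x [^] j \<notin> A"
    and z: "z ^ k = c (x [^] k)"
  shows "\<exists>A' c'. subgroup A' G \<and> A \<subseteq> A' \<and> x \<in> A' \<and> character_on G A' c' \<and>
           (\<forall>a\<in>A. c' a = c a) \<and> c' x = z"
proof -
  note [simp] = x
  have AG [simp]: "a \<in> carrier G" if "a \<in> A" for a
    using subgroup.mem_carrier[OF A that] .
  note Amult = subgroup.m_closed[OF A] and Aone = subgroup.one_closed[OF A]
    and Ainv = subgroup.m_inv_closed[OF A]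
  have cmult: "c (a \<otimes> b) = c a * c b" if "a \<in> A" "b \<in> A" for a b
    using c that by (simp add: character_on_def)
  have c1: "c \<one> = 1" using c by (simp add: character_on_def)
  have xpow: "c (x [^] d) = z ^ d" if d: "x [^] d \<in> A" for d :: nat
  proof -
    have split: "x [^] d = (x [^] k) [^] (d div k) \<otimes> x [^] (d mod k)"
      by (simp add: nat_pow_pow nat_pow_mult)
    have inA: "(x [^] k) [^] (d div k) \<in> A"
      using subgroup_nat_pow_closed[OF A k(2)] .
    have "x [^] (d mod k) = inv ((x [^] k) [^] (d div k)) \<otimes> x [^] d"
      using split by (simp add: inv_solve_left)
    then have "x [^] (d mod k) \<in> A"
      using Ainv[OF inA] d Amult by simp
    then have "d mod k = 0"
      using least[of "d mod k"] k(1) by (meson mod_less_divisor neq0_conv)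
    then have "d = k * (d div k)" by auto
    then have eq: "x [^] d = (x [^] k) [^] (d div k)" "z ^ d = (z ^ k) ^ (d div k)"
      by (metis nat_pow_pow x, metis power_mult)
    show ?thesis unfolding eq z by (rule character_on_pow[OF A c k(2)])
  qed
  have wd_le: "c a * z ^ j = c a' * z ^ j'"
    if "a \<in> A" "a' \<in> A" "a \<otimes> x [^] j = a' \<otimes> x [^] j'" "j \<le> j'" for a a' and j j' :: nat
  proof -
    obtain d where d: "j' = d + j" using \<open>j \<le> j'\<close> by (metis add.commute le_Suc_ex)
    have "a' \<otimes> x [^] j' = (a' \<otimes> x [^] d) \<otimes> x [^] j"
      unfolding d using that by (simp add: m_assoc nat_pow_mult)
    then have a: "a = a' \<otimes> x [^] d"
      using that by (metis AG m_closed nat_pow_closed right_cancel x)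
    then have "x [^] d = inv a' \<otimes> a"
      using that by (simp add: inv_solve_left)
    then have "x [^] d \<in> A" using that Ainv Amult by simp
    then show ?thesis unfolding a d using that xpow cmult by (simp add: power_add)
  qed
  have wd: "c a * z ^ j = c a' * z ^ j'"
    if "a \<in> A" "a' \<in> A" "a \<otimes> x [^] j = a' \<otimes> x [^] j'" for a a' and j j' :: nat
    using wd_le[of a a' j j'] wd_le[of a' a j' j] that by (metis nle_le)
  define A' where "A' = {a \<otimes> x [^] j | a (j::nat). a \<in> A}"
  define c' where "c' y = (SOME w. \<exists>a\<in>A. \<exists>j::nat. y = a \<otimes> x [^] j \<and> w = c a * z ^ j)" for y
  have c'_eq: "c' (a \<otimes> x [^] j) = c a * z ^ j" if "a \<in> A" for a and j :: nat
  proof -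
    have "\<exists>b\<in>A. \<exists>i::nat. a \<otimes> x [^] j = b \<otimes> x [^] i \<and> c' (a \<otimes> x [^] j) = c b * z ^ i"
      unfolding c'_def by (rule someI_ex) (use that in blast)
    then show ?thesis using wd that by metis
  qed
  have mult_rep: "(a \<otimes> x [^] i) \<otimes> (b \<otimes> x [^] j) = (a \<otimes> b) \<otimes> x [^] (i + j)"
    if "a \<in> A" "b \<in> A" for a b and i j :: nat
    using that by (simp add: nat_pow_mult[symmetric] m_ac)
  have "subgroup A' G"
  proof (rule subgroupI)
    show "A' \<subseteq> carrier G" by (auto simp: A'_def)
    show "A' \<noteq> {}" using Aone by (auto simp: A'_def)
  next
    fix y assume "y \<in> A'"
    then obtain a j where y: "y = a \<otimes> x [^] (j::nat)" "a \<in> A" by (auto simp: A'_def)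
    \<comment> \<open>the exponent $-j$ is traded for $(k-1)j$ by moving a power of $x^k$ into $A$\<close>
    define b where "b = inv a \<otimes> inv ((x [^] k) [^] j)"
    have b: "b \<in> A" unfolding b_def
      using Ainv y(2) subgroup_nat_pow_closed[OF A k(2)] Amult by blast
    have X: "x [^] ((k - 1) * j) \<otimes> x [^] j = (x [^] k) [^] j"
    proof -
      have "(k - 1) * j + j = k * j" using k(1) by (cases k) auto
      then show ?thesis by (simp add: nat_pow_pow nat_pow_mult)
    qed
    have aG: "a \<in> carrier G" using y(2) by simp
    have regroup: "(p \<otimes> q \<otimes> r) \<otimes> (t \<otimes> s) = (p \<otimes> t) \<otimes> (q \<otimes> (r \<otimes> s))"
      if "p \<in> carrier G" "q \<in> carrier G" "r \<in> carrier G" "s \<in> carrier G" "t \<in> carrier G"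
      for p q r s t
      using that by (simp add: m_ac)
    define w where "w = (x [^] k) [^] j"
    have wG: "w \<in> carrier G" by (simp add: w_def)
    have "(b \<otimes> x [^] ((k - 1) * j)) \<otimes> y
        = (inv a \<otimes> a) \<otimes> (inv w \<otimes> (x [^] ((k - 1) * j) \<otimes> x [^] j))"
      unfolding b_def y(1) w_def[symmetric] using aG wG
      by (intro regroup) auto
    also have "\<dots> = \<one>" unfolding X w_def[symmetric] using aG wG by simp
    finally have "(b \<otimes> x [^] ((k - 1) * j)) \<otimes> y = \<one>" .
    then have "inv y = b \<otimes> x [^] ((k - 1) * j)"
      using y b by (intro inv_equality) auto
    then show "inv y \<in> A'" using b by (auto simp: A'_def)
  next
    fix y y' assume "y \<in> A'" "y' \<in> A'"
    then show "y \<otimes> y' \<in> A'"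
      unfolding A'_def using mult_rep Amult by (smt (verit) mem_Collect_eq)
  qed
  moreover have "A \<subseteq> A'"
  proof
    fix a assume "a \<in> A"
    then show "a \<in> A'" unfolding A'_def by (intro CollectI exI[of _ a] exI[of _ "0::nat"]) auto
  qed
  moreover have "x \<in> A'"
    unfolding A'_def using Aone by (intro CollectI exI[of _ \<one>] exI[of _ "1::nat"]) auto
  moreover have "character_on G A' c'"
    unfolding character_on_def
  proof safe
    show "c' \<one> = 1" using c'_eq[of \<one> 0] Aone c1 by simp
  next
    fix y y' assume "y \<in> A'" "y' \<in> A'"
    then obtain a i b j where "y = a \<otimes> x [^] (i::nat)" "a \<in> A" "y' = b \<otimes> x [^] (j::nat)" "b \<in> A"
      by (auto simp: A'_def)
    then show "c' (y \<otimes> y') = c' y * c' y'"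
      using mult_rep c'_eq Amult cmult by (simp add: power_add)
  qed
  moreover have "c' a = c a" if "a \<in> A" for a
    using c'_eq[of a 0] that by simp
  moreover have "c' x = z" using c'_eq[of \<one> 1] Aone c1 by simp
  ultimately show ?thesis by blast
qed

lemma least_power_in_subgroup:
  assumes fin: "finite (carrier G)" and A: "subgroup A G" and x: "x \<in> carrier G"
  shows "\<exists>k::nat. k > 0 \<and> x [^] k \<in> A \<and> (\<forall>j::nat. 0 < j \<and> j < k \<longrightarrow> x [^] j \<notin> A)"
proof -
  have "order G > 0 \<and> x [^] order G \<in> A"
    using fin x pow_order_eq_1 subgroup.one_closed[OF A] order_gt_0_iff_finite by simp
  then have ex: "\<exists>k::nat. k > 0 \<and> x [^] k \<in> A" by blast
  define k where "k = (LEAST k::nat. k > 0 \<and> x [^] k \<in> A)"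
  have "k > 0 \<and> x [^] k \<in> A" unfolding k_def by (rule LeastI_ex[OF ex])
  moreover have "x [^] j \<notin> A" if "0 < j" "j < k" for j :: nat
    using not_less_Least[OF that(2)[unfolded k_def]] that(1) by blast
  ultimately show ?thesis by blast
qed

lemma character_extension:
  assumes fin: "finite (carrier G)" and "subgroup A G" "character_on G A c"
  shows "\<exists>c'. character_on G (carrier G) c' \<and> (\<forall>a\<in>A. c' a = c a)"
  using assms(2,3)
proof (induction "card (carrier G) - card A" arbitrary: A c rule: less_induct)
  case less
  note A = less.prems(1) and c = less.prems(2)
  show ?case
  proof (cases "A = carrier G")
    case True
    then show ?thesis using c by blast
  next
    case False
    then obtain x where x: "x \<in> carrier G" "x \<notin> A" using subgroup.subset[OF A] by blast
    obtain k :: nat where k: "k > 0" "x [^] k \<in> A" "\<And>j::nat. 0 < j \<Longrightarrow> j < k \<Longrightarrow> x [^] j \<notin> A"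
      using least_power_in_subgroup[OF fin A x(1)] by metis
    obtain z where z: "c (x [^] k) = z ^ k" using exists_complex_root k(1) by blast
    obtain A' c' where A': "subgroup A' G" "A \<subseteq> A'" "x \<in> A'" "character_on G A' c'"
      "\<forall>a\<in>A. c' a = c a"
      using character_extend_by_element[OF A c x(1) k z[symmetric]] by blast
    have "A \<subset> A'" "A' \<subseteq> carrier G" using A' x(2) subgroup.subset by blast+
    then have "card A < card A'" "card A' \<le> card (carrier G)"
      using fin by (meson finite_subset psubset_card_mono card_mono)+
    then have "card (carrier G) - card A' < card (carrier G) - card A" by linarith
    from less.hyps[OF this A'(1,4)] A'(2,5) show ?thesis by (metis subsetD)
  qed
qed

text \<open>
  For \<open>x\<close> outside \<open>A\<close> the least exponent \<open>k\<close> exceeds 1, so the trivial character of \<open>A\<close> can be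
  extended with a nontrivial \<open>k\<close>-th root of unity as its value at \<open>x\<close>.
\<close>

lemma character_separates:
  assumes fin: "finite (carrier G)" and A: "subgroup A G" and x: "x \<in> carrier G" "x \<notin> A"
  shows "\<exists>c. character_on G (carrier G) c \<and> (\<forall>a\<in>A. c a = 1) \<and> c x \<noteq> 1"
proof -
  obtain k :: nat where k: "k > 0" "x [^] k \<in> A" "\<And>j::nat. 0 < j \<Longrightarrow> j < k \<Longrightarrow> x [^] j \<notin> A"
    using least_power_in_subgroup[OF fin A x(1)] by metis
  have "k \<noteq> 1" using k(2) x by auto
  then have k2: "k > 1" using k(1) by linarith
  define z where "z = cis (2 * pi / k)"
  have zk: "z ^ k = 1" using k(1) by (simp add: z_def Complex.DeMoivre)
  have z1: "z \<noteq> 1"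
  proof
    assume "z = 1"
    then have "cos (2 * pi / k) = 1" by (metis cis.sel(1) one_complex.sel(1) z_def)
    then obtain i :: int where "2 * pi / k = of_int i * 2 * pi"
      using cos_one_2pi_int by blast
    then have "2 * pi * (1 / real k) = 2 * pi * of_int i" by (simp only: mult_ac times_divide_eq_right)
    then have "1 / real k = of_int i"
      by (rule mult_left_cancel[THEN iffD1, rotated]) simp
    then have "real k * of_int i = 1" using k(1) by (simp add: field_simps)
    then have "int k * i = 1" by (metis of_int_eq_1_iff of_int_mult of_int_of_nat_eq)
    then have "int k dvd 1" by (metis dvd_triv_left)
    then show False using k2 by simp
  qed
  have triv: "character_on G A (\<lambda>_. 1)" by (simp add: character_on_def)
  obtain A' c where "subgroup A' G" "A \<subseteq> A'" "x \<in> A'" "character_on G A' c"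
      "\<forall>a\<in>A. c a = 1" "c x = z"
    using character_extend_by_element[OF A triv x(1) k zk] by blast
  moreover then obtain c' where "character_on G (carrier G) c'" "\<forall>a\<in>A'. c' a = c a"
    using character_extension[OF fin] by blast
  ultimately show ?thesis using z1 by (metis subsetD)
qed

end

section \<open>Additive characters of a finite ring\<close>

definition chars :: "('a::comm_ring_1 \<Rightarrow> complex) set" where
  "chars = {f. f 0 = 1 \<and> (\<forall>x y. f (x + y) = f x * f y)}"

lemma chars_add: "f \<in> chars \<Longrightarrow> f (x + y) = f x * f y"
  and chars_zero: "f \<in> chars \<Longrightarrow> f 0 = 1"
  by (auto simp: chars_def)

lemma chars_one [simp]: "(\<lambda>_. 1) \<in> chars"
  and chars_mult: "f \<in> chars \<Longrightarrow> g \<in> chars \<Longrightarrow> (\<lambda>x. f x * g x) \<in> chars"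
  and chars_scale: "f \<in> chars \<Longrightarrow> (\<lambda>x. f (r * x)) \<in> chars"
  by (auto simp: chars_def distrib_left)

lemma chars_nonzero:
  assumes "f \<in> chars" shows "f x \<noteq> 0"
proof -
  have "f x * f (- x) = 1" using chars_add[OF assms, of x "-x"] chars_zero[OF assms] by simp
  then show ?thesis by auto
qed

text \<open>
  Translation by \<open>x\<close> permutes the ring, and it multiplies the product of all values of \<open>f\<close> by
  this power of \<open>f x\<close>.
\<close>

lemma chars_power_card:
  fixes f :: "'a::{finite,comm_ring_1} \<Rightarrow> complex"
  assumes "f \<in> chars" shows "f x ^ CARD('a) = 1"
proof -
  have "bij_betw (\<lambda>y. x + y) UNIV UNIV"
    by (intro bij_betwI[where g = "\<lambda>y. y - x"]) auto
  then have "(\<Prod>y\<in>UNIV. f y) = (\<Prod>y\<in>UNIV. f (x + y))"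
    by (rule prod.reindex_bij_betw[symmetric])
  also have "\<dots> = f x ^ CARD('a) * (\<Prod>y\<in>UNIV. f y)"
    by (simp add: chars_add[OF assms] prod.distrib)
  finally show ?thesis using chars_nonzero[OF assms] by auto
qed

lemma norm_chars:
  fixes f :: "'a::{finite,comm_ring_1} \<Rightarrow> complex"
  assumes "f \<in> chars" shows "norm (f x) = 1"
proof -
  have "norm (f x) ^ CARD('a) = 1 ^ CARD('a)"
    by (simp add: norm_power[symmetric] chars_power_card[OF assms])
  then show ?thesis by (rule power_eq_imp_eq_base) auto
qed

lemma finite_chars: "finite (chars :: ('a::{finite,comm_ring_1} \<Rightarrow> complex) set)"
proof (rule finite_subset)
  show "chars \<subseteq> PiE (UNIV::'a set) (\<lambda>_. {z::complex. z ^ CARD('a) = 1})"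
    using chars_power_card by auto
  show "finite (PiE (UNIV::'a set) (\<lambda>_. {z::complex. z ^ CARD('a) = 1}))"
    by (intro finite_PiE finite_nth_roots) auto
qed

lemma chars_minus:
  fixes f :: "'a::{finite,comm_ring_1} \<Rightarrow> complex"
  assumes "f \<in> chars" shows "f (- x) = cnj (f x)"
proof -
  have "f (-x) * f x = 1" using chars_add[OF assms, of "-x" x] chars_zero[OF assms] by simp
  moreover have "cnj (f x) * f x = 1"
    using norm_chars[OF assms, of x] complex_norm_square[of "f x"] by (simp add: mult.commute)
  ultimately show ?thesis by (metis chars_nonzero[OF assms] mult_right_cancel)
qed

text \<open>
  The common core of all orthogonality relations below: a sum that is multiplied by \<open>c \<noteq> 1\<close> when its
  index set is permuted must vanish.
\<close>

lemma sum_eq_0_of_scaling: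
  fixes f :: "'b \<Rightarrow> complex"
  assumes "bij_betw g S S" "\<And>s. s \<in> S \<Longrightarrow> f (g s) = c * f s" "c \<noteq> 1"
  shows "sum f S = 0"
proof -
  have "sum f S = (\<Sum>s\<in>S. f (g s))" by (rule sum.reindex_bij_betw[OF assms(1), symmetric])
  also have "\<dots> = c * sum f S" by (simp add: assms(2) sum_distrib_left)
  finally show ?thesis using assms(3) by (simp add: mult_cancel_right1)
qed

lemma sum_chars:
  fixes f :: "'a::{finite,comm_ring_1} \<Rightarrow> complex"
  assumes "f \<in> chars"
  shows "(\<Sum>x\<in>UNIV. f x) = (if f = (\<lambda>_. 1) then of_nat CARD('a) else 0)"
proof (cases "f = (\<lambda>_. 1)")
  case False
  then obtain a where "f a \<noteq> 1" by auto
  moreover have "bij_betw (\<lambda>y. a + y) UNIV UNIV"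
    by (intro bij_betwI[where g = "\<lambda>y. y - a"]) auto
  ultimately have "sum f UNIV = 0"
    by (intro sum_eq_0_of_scaling[where c = "f a" and g = "\<lambda>y. a + y"])
       (simp_all add: chars_add[OF assms])
  then show ?thesis using False by simp
qed simp

text \<open>
  A set of characters that is closed under multiplication is closed under inverses as well, since
  a finite ring has finitely many characters.
\<close>

definition char_subgroup :: "('a::comm_ring_1 \<Rightarrow> complex) set \<Rightarrow> bool" where
  "char_subgroup L \<longleftrightarrow> L \<subseteq> chars \<and> (\<lambda>_. 1) \<in> L \<and> (\<forall>f\<in>L. \<forall>g\<in>L. (\<lambda>x. f x * g x) \<in> L)"

text \<open>
  Summing \<open>f x\<close> over all \<open>f\<close> in \<open>L\<close> and all \<open>x\<close>, in the two possible orders, counts the left hand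
  side and the right hand side.
\<close>

lemma card_char_subgroup_annihilator:
  fixes L :: "('a::{finite,comm_ring_1} \<Rightarrow> complex) set"
  assumes L: "char_subgroup L"
  shows "card L * card {x. \<forall>f\<in>L. f x = 1} = CARD('a)"
proof -
  let ?K = "{x. \<forall>f\<in>L. f x = 1}"
  have Lc: "L \<subseteq> chars" using L by (simp add: char_subgroup_def)
  have fin: "finite L" using finite_subset[OF Lc finite_chars] .
  have inner: "(\<Sum>f\<in>L. f x) = (if x \<in> ?K then of_nat (card L) else 0)" for x
  proof (cases "x \<in> ?K")
    case False
    then obtain g where g: "g \<in> L" "g x \<noteq> 1" by auto
    let ?h = "\<lambda>f y. g y * f y"
    have "inj_on ?h L"
    proof (intro inj_onI ext)
      fix f f' y assume "?h f = ?h f'"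
      then have "g y * f y = g y * f' y" by (rule fun_cong)
      moreover have "g y \<noteq> 0" using chars_nonzero Lc g(1) by blast
      ultimately show "f y = f' y" by simp
    qed
    moreover have "?h ` L \<subseteq> L" using L g(1) by (auto simp: char_subgroup_def)
    ultimately have "bij_betw ?h L L" using fin by (simp add: endo_inj_surj bij_betw_def)
    then have "(\<Sum>f\<in>L. f x) = 0" by (rule sum_eq_0_of_scaling) (use g in auto)
    then show ?thesis by (simp only: False if_False)
  next
    case True
    then have "(\<Sum>f\<in>L. f x) = (\<Sum>f\<in>L. 1)" by (intro sum.cong) auto
    then show ?thesis by (simp only: True if_True sum_constant mult_1_right)
  qed
  have "(of_nat (card L * card ?K) :: complex) = (\<Sum>x\<in>UNIV. \<Sum>f\<in>L. f x)"
    by (simp add: inner sum.If_cases)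
  also have "\<dots> = (\<Sum>f\<in>L. \<Sum>x\<in>UNIV. f x)" by (rule sum.swap)
  also have "\<dots> = (\<Sum>f\<in>L. if f = (\<lambda>_. 1) then of_nat CARD('a) else 0)"
    using Lc by (intro sum.cong refl sum_chars) auto
  also have "\<dots> = of_nat CARD('a)"
    using fin L by (simp add: sum.delta char_subgroup_def)
  finally show ?thesis by (simp only: of_nat_eq_iff)
qed

section \<open>Characters of vectors\<close>

lemma bij_betw_vec: "bij_betw (vec n) (PiE {..<n} (\<lambda>_. UNIV)) (carrier_vec n)"
proof (rule bij_betwI[where g = "\<lambda>v. \<lambda>i\<in>{..<n}. v $ i"])
  fix f :: "nat \<Rightarrow> 'a" assume f: "f \<in> PiE {..<n} (\<lambda>_. UNIV)"
  show "(\<lambda>i\<in>{..<n}. vec n f $ i) = f"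
    by (rule extensionalityI[of _ "{..<n}"]) (use f in \<open>auto simp: PiE_iff\<close>)
next
  fix v :: "'a vec" assume v: "v \<in> carrier_vec n"
  show "vec n (\<lambda>i\<in>{..<n}. v $ i) = v"
    by (rule eq_vecI) (use v in auto)
qed auto

lemma bij_betw_mat:
  "bij_betw (mat n m) (PiE ({..<n} \<times> {..<m}) (\<lambda>_. UNIV)) (carrier_mat n m)"
proof (rule bij_betwI[where g = "\<lambda>X. \<lambda>ij\<in>{..<n} \<times> {..<m}. X $$ ij"])
  fix f :: "nat \<times> nat \<Rightarrow> 'a" assume f: "f \<in> PiE ({..<n} \<times> {..<m}) (\<lambda>_. UNIV)"
  show "(\<lambda>ij\<in>{..<n} \<times> {..<m}. mat n m f $$ ij) = f"
    by (rule extensionalityI[of _ "{..<n} \<times> {..<m}"]) (use f in \<open>auto simp: PiE_iff\<close>)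
next
  fix X :: "'a mat" assume X: "X \<in> carrier_mat n m"
  show "mat n m (\<lambda>ij\<in>{..<n} \<times> {..<m}. X $$ ij) = X"
    by (rule eq_matI) (use X in auto)
qed auto

lemma sum_carrier_vec_prod:
  fixes h :: "nat \<Rightarrow> 'a::finite \<Rightarrow> 'c::comm_semiring_1"
  shows "(\<Sum>v\<in>carrier_vec n. \<Prod>i<n. h i (v $ i)) = (\<Prod>i<n. \<Sum>x\<in>UNIV. h i x)"
proof -
  note bij = bij_betw_vec[of n, where 'a = 'a]
  have "(\<Sum>v\<in>carrier_vec n. \<Prod>i<n. h i (v $ i)) =
        (\<Sum>f\<in>PiE {..<n} (\<lambda>_. UNIV). \<Prod>i<n. h i (vec n f $ i))"
    by (rule sum.reindex_bij_betw[OF bij, symmetric])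
  also have "\<dots> = (\<Sum>f\<in>PiE {..<n} (\<lambda>_. UNIV). \<Prod>i<n. h i (f i))"
    by (intro sum.cong prod.cong) auto
  also have "\<dots> = (\<Prod>i<n. \<Sum>x\<in>UNIV. h i x)"
    by (rule prod_sum_PiE[symmetric]) auto
  finally show ?thesis .
qed

lemma sum_carrier_mat_prod:
  fixes h :: "nat \<times> nat \<Rightarrow> 'a::finite \<Rightarrow> 'c::comm_semiring_1"
  shows "(\<Sum>X\<in>carrier_mat n m. \<Prod>ij\<in>{..<n}\<times>{..<m}. h ij (X $$ ij)) =
         (\<Prod>ij\<in>{..<n}\<times>{..<m}. \<Sum>x\<in>UNIV. h ij x)"
proof -
  note bij = bij_betw_mat[of n m, where 'a = 'a]
  have "(\<Sum>X\<in>carrier_mat n m. \<Prod>ij\<in>{..<n}\<times>{..<m}. h ij (X $$ ij)) =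
        (\<Sum>f\<in>PiE ({..<n}\<times>{..<m}) (\<lambda>_. UNIV). \<Prod>ij\<in>{..<n}\<times>{..<m}. h ij (mat n m f $$ ij))"
    by (rule sum.reindex_bij_betw[OF bij, symmetric])
  also have "\<dots> = (\<Sum>f\<in>PiE ({..<n}\<times>{..<m}) (\<lambda>_. UNIV). \<Prod>ij\<in>{..<n}\<times>{..<m}. h ij (f ij))"
    by (intro sum.cong prod.cong) auto
  also have "\<dots> = (\<Prod>ij\<in>{..<n}\<times>{..<m}. \<Sum>x\<in>UNIV. h ij x)"
    by (rule prod_sum_PiE[symmetric]) auto
  finally show ?thesis .
qed

lemma finite_carrier_vec: "finite (carrier_vec n :: 'a::finite vec set)"
  and card_carrier_vec: "card (carrier_vec n :: 'a::finite vec set) = CARD('a) ^ n"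
proof -
  note bij = bij_betw_vec[of n, where 'a = 'a]
  show "finite (carrier_vec n :: 'a vec set)"
    using bij_betw_finite[OF bij] by (simp add: finite_PiE)
  show "card (carrier_vec n :: 'a vec set) = CARD('a) ^ n"
    using bij_betw_same_card[OF bij] by (simp add: card_PiE)
qed

text \<open>
  The characters of the additive group of vectors of length \<open>n\<close> are the products of \<open>n\<close> characters of
  the ring, one for each coordinate; they are represented by the tuples of their factors.
\<close>

definition char_vecs :: "nat \<Rightarrow> (nat \<Rightarrow> 'a::comm_ring_1 \<Rightarrow> complex) set" where
  "char_vecs n = PiE {..<n} (\<lambda>_. chars)"

definition trivial_char_vec :: "nat \<Rightarrow> nat \<Rightarrow> 'a::comm_ring_1 \<Rightarrow> complex" where
  "trivial_char_vec n = (\<lambda>i\<in>{..<n}. \<lambda>_. 1)"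

definition eval_char :: "nat \<Rightarrow> (nat \<Rightarrow> 'a::comm_ring_1 \<Rightarrow> complex) \<Rightarrow> 'a vec \<Rightarrow> complex" where
  "eval_char n w v = (\<Prod>i<n. w i (v $ i))"

definition annihilator :: "nat \<Rightarrow> 'a::comm_ring_1 vec set \<Rightarrow> (nat \<Rightarrow> 'a \<Rightarrow> complex) set" where
  "annihilator n B = {w \<in> char_vecs n. \<forall>v\<in>B. eval_char n w v = 1}"

definition add_subgroup :: "nat \<Rightarrow> 'a::comm_ring_1 vec set \<Rightarrow> bool" where
  "add_subgroup n B \<longleftrightarrow> B \<subseteq> carrier_vec n \<and> 0\<^sub>v n \<in> B \<and>
     (\<forall>x\<in>B. - x \<in> B) \<and> (\<forall>x\<in>B. \<forall>y\<in>B. x + y \<in> B)"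

lemma char_vecs_nth: "w \<in> char_vecs n \<Longrightarrow> i < n \<Longrightarrow> w i \<in> chars"
  by (auto simp: char_vecs_def)

lemma finite_char_vecs: "finite (char_vecs n :: (nat \<Rightarrow> 'a::{finite,comm_ring_1} \<Rightarrow> complex) set)"
  unfolding char_vecs_def by (intro finite_PiE) (auto simp: finite_chars)

lemma trivial_char_vec_in: "trivial_char_vec n \<in> char_vecs n"
  by (auto simp: char_vecs_def trivial_char_vec_def)

lemma eval_trivial_char_vec [simp]: "eval_char n (trivial_char_vec n) v = 1"
  by (simp add: eval_char_def trivial_char_vec_def)

lemma trivial_char_vec_iff:
  assumes "w \<in> char_vecs n"
  shows "w = trivial_char_vec n \<longleftrightarrow> (\<forall>i<n. w i = (\<lambda>_. 1))"
proof
  assume "\<forall>i<n. w i = (\<lambda>_. 1)"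
  then show "w = trivial_char_vec n"
    using assms by (intro extensionalityI[of _ "{..<n}"]) (auto simp: char_vecs_def trivial_char_vec_def PiE_iff)
qed (simp add: trivial_char_vec_def)

lemma eval_char_add:
  assumes "w \<in> char_vecs n" "x \<in> carrier_vec n" "y \<in> carrier_vec n"
  shows "eval_char n w (x + y) = eval_char n w x * eval_char n w y"
  unfolding eval_char_def prod.distrib[symmetric]
  by (intro prod.cong refl) (use assms in \<open>simp add: chars_add[OF char_vecs_nth[OF assms(1)]]\<close>)

lemma eval_char_minus:
  fixes w :: "nat \<Rightarrow> 'a::{finite,comm_ring_1} \<Rightarrow> complex"
  assumes "w \<in> char_vecs n" "y \<in> carrier_vec n"
  shows "eval_char n w (- y) = cnj (eval_char n w y)"
  unfolding eval_char_def cnj_prod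
  by (intro prod.cong refl) (use assms in \<open>simp add: chars_minus[OF char_vecs_nth[OF assms(1)]]\<close>)

lemma eval_char_diff:
  fixes w :: "nat \<Rightarrow> 'a::{finite,comm_ring_1} \<Rightarrow> complex"
  assumes "w \<in> char_vecs n" "x \<in> carrier_vec n" "y \<in> carrier_vec n"
  shows "eval_char n w (x - y) = eval_char n w x * cnj (eval_char n w y)"
proof -
  have "x - y = x + (- y)" using assms by auto
  then show ?thesis using assms by (simp add: eval_char_add eval_char_minus)
qed

lemma norm_eval_char:
  fixes w :: "nat \<Rightarrow> 'a::{finite,comm_ring_1} \<Rightarrow> complex"
  assumes "w \<in> char_vecs n"
  shows "norm (eval_char n w v) = 1"
  unfolding eval_char_def prod_norm[symmetric]
  by (intro prod.neutral) (simp add: norm_chars[OF char_vecs_nth[OF assms]])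

lemma sum_eval_char:
  fixes w :: "nat \<Rightarrow> 'a::{finite,comm_ring_1} \<Rightarrow> complex"
  assumes w: "w \<in> char_vecs n"
  shows "(\<Sum>v\<in>carrier_vec n. eval_char n w v) =
           (if w = trivial_char_vec n then of_nat (CARD('a) ^ n) else 0)"
proof -
  have "(\<Sum>v\<in>carrier_vec n. eval_char n w v) = (\<Prod>i<n. \<Sum>x\<in>UNIV. w i x)"
    unfolding eval_char_def by (rule sum_carrier_vec_prod)
  also have "\<dots> = (\<Prod>i<n. if w i = (\<lambda>_. 1) then of_nat CARD('a) else 0)"
    by (intro prod.cong refl sum_chars char_vecs_nth[OF w]) auto
  also have "\<dots> = (if w = trivial_char_vec n then of_nat (CARD('a) ^ n) else 0)"
  proof (cases "w = trivial_char_vec n")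
    case True
    then show ?thesis by (simp add: trivial_char_vec_def)
  next
    case False
    then obtain i where "i < n" "w i \<noteq> (\<lambda>_. 1)" using trivial_char_vec_iff[OF w] by blast
    then have "(\<Prod>i<n. if w i = (\<lambda>_. 1) then of_nat CARD('a) else 0) = (0::complex)"
      by (intro prod_zero) auto
    then show ?thesis using False by simp
  qed
  finally show ?thesis .
qed

lemma add_subgroup_imp_subgroup:
  fixes B :: "'a::comm_ring_1 vec set"
  assumes "add_subgroup n B"
  shows "subgroup B (monoid_vec TYPE('a) n)"
proof -
  interpret comm_group "monoid_vec TYPE('a) n" by (rule comm_group_vec)
  show ?thesis
  proof (rule subgroupI)
    fix x assume x: "x \<in> B"
    then have "x \<in> carrier_vec n" using assms by (auto simp: add_subgroup_def)
    then have "inv\<^bsub>monoid_vec TYPE('a) n\<^esub> x = - x"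
      by (intro inv_equality) (auto simp: monoid_vec_simps)
    then show "inv\<^bsub>monoid_vec TYPE('a) n\<^esub> x \<in> B" using x assms by (simp add: add_subgroup_def)
  qed (use assms in \<open>auto simp: add_subgroup_def monoid_vec_simps\<close>)
qed

text \<open>
  The factor at coordinate \<open>i\<close> is the restriction of \<open>c\<close> to the multiples of the unit vector \<open>i\<close>.
\<close>

lemma character_on_vec_eq_eval_char:
  fixes c :: "'a::comm_ring_1 vec \<Rightarrow> complex"
  assumes c: "character_on (monoid_vec TYPE('a) n) (carrier_vec n) c"
  shows "\<exists>w\<in>char_vecs n. \<forall>v\<in>carrier_vec n. eval_char n w v = c v"
proof -
  have c0: "c (0\<^sub>v n) = 1" using c by (auto simp: character_on_def monoid_vec_simps)
  have cadd: "c (x + y) = c x * c y" if "x \<in> carrier_vec n" "y \<in> carrier_vec n" for x y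
    using c that by (auto simp: character_on_def monoid_vec_simps)
  define w where "w = (\<lambda>i\<in>{..<n}. \<lambda>t. c (t \<cdot>\<^sub>v unit_vec n i))"
  have "0 \<cdot>\<^sub>v unit_vec n i = (0\<^sub>v n :: 'a vec)" for i by (intro eq_vecI) auto
  then have "w i \<in> chars" if "i < n" for i
    using that by (auto simp: w_def chars_def c0 add_smult_distrib_vec cadd)
  then have "w \<in> char_vecs n" by (auto simp: char_vecs_def w_def)
  moreover have "eval_char n w v = c v" if v: "v \<in> carrier_vec n" for v
  proof -
    have "c (vec n (\<lambda>i. if i < k then v $ i else 0)) = (\<Prod>i<k. w i (v $ i))" if "k \<le> n" for k
      using that
    proof (induction k)
      case 0
      have "vec n (\<lambda>i. 0) = (0\<^sub>v n :: 'a vec)" by auto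
      then show ?case using c0 by simp
    next
      case (Suc k)
      have "vec n (\<lambda>i. if i < Suc k then v $ i else 0) =
            vec n (\<lambda>i. if i < k then v $ i else 0) + (v $ k) \<cdot>\<^sub>v unit_vec n k"
        by (rule eq_vecI) (auto simp: less_Suc_eq unit_vec_def)
      then show ?case using Suc by (simp add: cadd w_def)
    qed
    from this[of n] have "eval_char n w v = c (vec n (\<lambda>i. if i < n then v $ i else 0))"
      by (simp add: eval_char_def)
    also have "vec n (\<lambda>i. if i < n then v $ i else 0) = v" using v by (intro eq_vecI) auto
    finally show ?thesis .
  qed
  ultimately show ?thesis by blast
qed

lemma annihilator_separates:
  fixes B :: "'a::{finite,comm_ring_1} vec set"
  assumes "add_subgroup n B" "v \<in> carrier_vec n" "v \<notin> B"
  shows "\<exists>w\<in>annihilator n B. eval_char n w v \<noteq> 1"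
proof -
  interpret comm_group "monoid_vec TYPE('a) n" by (rule comm_group_vec)
  have "finite (carrier (monoid_vec TYPE('a) n))"
    by (simp add: monoid_vec_simps finite_carrier_vec)
  then obtain c where c: "character_on (monoid_vec TYPE('a) n) (carrier_vec n) c"
    "\<forall>a\<in>B. c a = 1" "c v \<noteq> 1"
    using character_separates[OF _ add_subgroup_imp_subgroup[OF assms(1)], of v] assms
    by (auto simp: monoid_vec_simps)
  obtain w where "w \<in> char_vecs n" "\<forall>v\<in>carrier_vec n. eval_char n w v = c v"
    using character_on_vec_eq_eval_char[OF c(1)] by blast
  moreover have "B \<subseteq> carrier_vec n" using assms(1) by (simp add: add_subgroup_def)
  ultimately show ?thesis using c assms(2)
    by (intro bexI[of _ w]) (auto simp: annihilator_def)
qed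

definition mult_char_vec ::
  "nat \<Rightarrow> (nat \<Rightarrow> 'a::comm_ring_1 \<Rightarrow> complex) \<Rightarrow> (nat \<Rightarrow> 'a \<Rightarrow> complex) \<Rightarrow> nat \<Rightarrow> 'a \<Rightarrow> complex"
  where "mult_char_vec n g w = (\<lambda>i\<in>{..<n}. \<lambda>x. g i x * w i x)"

lemma eval_mult_char_vec:
  "eval_char n (mult_char_vec n g w) v = eval_char n g v * eval_char n w v"
  unfolding eval_char_def prod.distrib[symmetric]
  by (intro prod.cong refl) (simp add: mult_char_vec_def)

lemma finite_annihilator:
  "finite (annihilator n B :: (nat \<Rightarrow> 'a::{finite,comm_ring_1} \<Rightarrow> complex) set)"
  by (rule finite_subset[OF _ finite_char_vecs]) (auto simp: annihilator_def)

text \<open>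
  The Fourier expansion of the indicator function of \<open>B\<close>. Off \<open>B\<close> the sum vanishes because some
  character \<open>g\<close> that is trivial on \<open>B\<close> is nontrivial at \<open>v\<close>, and multiplication by \<open>g\<close> permutes the
  annihilator.
\<close>

lemma sum_annihilator:
  fixes B :: "'a::{finite,comm_ring_1} vec set"
  assumes B: "add_subgroup n B" and v: "v \<in> carrier_vec n"
  shows "(\<Sum>w\<in>annihilator n B. eval_char n w v) =
           (if v \<in> B then of_nat (card (annihilator n B)) else 0)"
proof (cases "v \<in> B")
  case True
  then have "(\<Sum>w\<in>annihilator n B. eval_char n w v) = (\<Sum>w\<in>annihilator n B. 1)"
    by (intro sum.cong) (auto simp: annihilator_def)
  then show ?thesis using True by simp
next
  case False
  then obtain g where g: "g \<in> annihilator n B" "eval_char n g v \<noteq> 1"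
    using annihilator_separates[OF B v] by blast
  have gc: "g \<in> char_vecs n" using g by (simp add: annihilator_def)
  have "inj_on (mult_char_vec n g) (annihilator n B)"
  proof (rule inj_onI)
    fix w w' assume w: "w \<in> annihilator n B" "w' \<in> annihilator n B"
      and eq: "mult_char_vec n g w = mult_char_vec n g w'"
    show "w = w'"
    proof (rule extensionalityI[of _ "{..<n}"])
      fix i assume i: "i \<in> {..<n}"
      show "w i = w' i"
      proof
        fix x
        have "g i x * w i x = g i x * w' i x"
          using fun_cong[OF fun_cong[OF eq, of i], of x] i by (simp add: mult_char_vec_def)
        then show "w i x = w' i x"
          using chars_nonzero[OF char_vecs_nth[OF gc]] i by simp
      qed
    qed (use w in \<open>auto simp: annihilator_def char_vecs_def PiE_iff\<close>)
  qed
  moreover have "mult_char_vec n g ` annihilator n B \<subseteq> annihilator n B"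
  proof
    fix w' assume "w' \<in> mult_char_vec n g ` annihilator n B"
    then obtain w where w: "w \<in> annihilator n B" "w' = mult_char_vec n g w" by blast
    have "w' \<in> char_vecs n"
      unfolding w(2) char_vecs_def mult_char_vec_def
      using w(1) gc by (intro restrict_PiE_iff[THEN iffD2] ballI chars_mult)
        (auto simp: annihilator_def char_vecs_nth)
    then show "w' \<in> annihilator n B"
      using w(1) g(1) unfolding w(2) annihilator_def by (auto simp: eval_mult_char_vec)
  qed
  ultimately have "bij_betw (mult_char_vec n g) (annihilator n B) (annihilator n B)"
    using finite_annihilator[of n B] by (simp add: endo_inj_surj bij_betw_def)
  then have "(\<Sum>w\<in>annihilator n B. eval_char n w v) = 0"
    by (rule sum_eq_0_of_scaling) (use g in \<open>simp_all add: eval_mult_char_vec\<close>)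
  then show ?thesis using False by simp
qed

lemma trivial_in_annihilator: "trivial_char_vec n \<in> annihilator n B"
  by (simp add: annihilator_def trivial_char_vec_in)

text \<open>
  Double counting of the sum of all \<open>eval_char n w v\<close> over the annihilator and over all vectors.
\<close>

lemma card_annihilator:
  fixes B :: "'a::{finite,comm_ring_1} vec set"
  assumes B: "add_subgroup n B"
  shows "card (annihilator n B) * card B = CARD('a) ^ n"
proof -
  have sub: "B \<subseteq> carrier_vec n" using B by (simp add: add_subgroup_def)
  have "(of_nat (card (annihilator n B) * card B) :: complex) =
        (\<Sum>v\<in>carrier_vec n. if v \<in> B then of_nat (card (annihilator n B)) else 0)"
  proof -
    have "(\<Sum>v\<in>carrier_vec n. if v \<in> B then (of_nat (card (annihilator n B)) :: complex) else 0)
        = (\<Sum>v\<in>B. of_nat (card (annihilator n B)))"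
      by (rule sum.mono_neutral_cong_right) (use sub finite_carrier_vec in auto)
    then show ?thesis by (simp add: mult.commute)
  qed
  also have "\<dots> = (\<Sum>v\<in>carrier_vec n. \<Sum>w\<in>annihilator n B. eval_char n w v)"
    by (intro sum.cong refl sum_annihilator[OF B, symmetric])
  also have "\<dots> = (\<Sum>w\<in>annihilator n B. \<Sum>v\<in>carrier_vec n. eval_char n w v)"
    by (rule sum.swap)
  also have "\<dots> = (\<Sum>w\<in>annihilator n B. if w = trivial_char_vec n then of_nat (CARD('a) ^ n) else 0)"
    by (intro sum.cong refl sum_eval_char) (simp add: annihilator_def)
  also have "\<dots> = of_nat (CARD('a) ^ n)"
    by (simp add: sum.delta finite_annihilator trivial_in_annihilator)
  finally show ?thesis by (simp only: of_nat_eq_iff)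
qed

section \<open>Total variation distance and Fourier coefficients\<close>

definition fourier :: "nat \<Rightarrow> 'a::{finite,comm_ring_1} vec pmf \<Rightarrow> (nat \<Rightarrow> 'a \<Rightarrow> complex) \<Rightarrow> complex"
  where "fourier n p w = (\<Sum>y\<in>carrier_vec n. of_real (pmf p y) * eval_char n w y)"

lemma pmf_plus_uniform:
  fixes p :: "'a::{finite,comm_ring_1} vec pmf"
  assumes p: "set_pmf p \<subseteq> carrier_vec n" and B: "add_subgroup n B" and x: "x \<in> carrier_vec n"
  shows "pmf (plus_uniform p B) x =
           (\<Sum>y\<in>carrier_vec n. pmf p y * (if x - y \<in> B then 1 / real (card B) else 0))"
proof -
  have sub: "B \<subseteq> carrier_vec n" and B0: "B \<noteq> {}" using B by (auto simp: add_subgroup_def)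
  have finB: "finite B" using finite_subset[OF sub finite_carrier_vec] .
  have shift: "pmf (map_pmf (\<lambda>b. y + b) (pmf_of_set B)) x = (if x - y \<in> B then 1 / real (card B) else 0)"
    if y: "y \<in> carrier_vec n" for y
  proof -
    have inj: "inj_on (\<lambda>b. y + b) B"
    proof (rule inj_onI)
      fix a b assume ab: "a \<in> B" "b \<in> B" "y + a = y + b"
      show "a = b"
      proof (rule eq_vecI)
        have d: "a \<in> carrier_vec n" "b \<in> carrier_vec n" using ab sub by auto
        then show "dim_vec a = dim_vec b" by simp
        fix i assume "i < dim_vec b"
        then show "a $ i = b $ i" using arg_cong[OF ab(3), of "\<lambda>v. v $ i"] d by simp
      qed
    qed
    have "x \<in> (\<lambda>b. y + b) ` B \<longleftrightarrow> x - y \<in> B"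
    proof
      assume "x \<in> (\<lambda>b. y + b) ` B"
      then obtain b where b: "b \<in> B" "x = y + b" by blast
      then have "x - y = b" using y sub by (auto intro!: eq_vecI)
      then show "x - y \<in> B" using b by simp
    next
      assume "x - y \<in> B"
      moreover have "x = y + (x - y)" using x y by (auto intro!: eq_vecI)
      ultimately show "x \<in> (\<lambda>b. y + b) ` B" by blast
    qed
    then show ?thesis
      using B0 finB by (simp add: map_pmf_of_set_inj[OF inj] card_image[OF inj] indicator_def)
  qed
  have "plus_uniform p B = bind_pmf p (\<lambda>y. map_pmf (\<lambda>b. y + b) (pmf_of_set B))"
    unfolding plus_uniform_def pair_pmf_def map_bind_pmf
    by (simp add: map_pmf_def bind_return_pmf)
  then have "pmf (plus_uniform p B) x =
      measure_pmf.expectation p (\<lambda>y. pmf (map_pmf (\<lambda>b. y + b) (pmf_of_set B)) x)"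
    by (simp add: pmf_bind)
  also have "\<dots> = (\<Sum>y\<in>carrier_vec n. pmf (map_pmf (\<lambda>b. y + b) (pmf_of_set B)) x * pmf p y)"
    using p by (intro integral_measure_pmf_real finite_carrier_vec) auto
  also have "\<dots> = (\<Sum>y\<in>carrier_vec n. pmf p y * (if x - y \<in> B then 1 / real (card B) else 0))"
    by (intro sum.cong refl) (simp add: shift)
  finally show ?thesis .
qed

text \<open>
  Adding a uniform element of \<open>B\<close> keeps the Fourier coefficients at the characters that are trivial
  on \<open>B\<close> and kills all others.
\<close>

lemma pmf_plus_uniform_fourier:
  fixes p :: "'a::{finite,comm_ring_1} vec pmf"
  assumes p: "set_pmf p \<subseteq> carrier_vec n" and B: "add_subgroup n B" and x: "x \<in> carrier_vec n"
  shows "of_real (pmf (plus_uniform p B) x) =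
     (\<Sum>w\<in>annihilator n B. eval_char n w x * cnj (fourier n p w)) / of_nat (CARD('a) ^ n)"
proof -
  let ?A = "annihilator n B" and ?N = "of_nat (CARD('a) ^ n) :: complex"
  have N: "?N = of_nat (card ?A) * of_nat (card B)" using card_annihilator[OF B] by (metis of_nat_mult)
  have N0: "?N \<noteq> 0" by simp
  have ind: "of_real (if x - y \<in> B then 1 / real (card B) else 0) =
      (\<Sum>w\<in>?A. eval_char n w x * cnj (eval_char n w y)) / ?N" if y: "y \<in> carrier_vec n" for y
  proof -
    have "(\<Sum>w\<in>?A. eval_char n w x * cnj (eval_char n w y)) = (\<Sum>w\<in>?A. eval_char n w (x - y))"
      using x y by (intro sum.cong refl eval_char_diff[symmetric]) (auto simp: annihilator_def)
    also have "\<dots> = (if x - y \<in> B then of_nat (card ?A) else 0)"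
      using x y by (intro sum_annihilator[OF B]) auto
    finally show ?thesis using N N0 by (auto simp: field_simps)
  qed
  have "complex_of_real (pmf (plus_uniform p B) x) =
     (\<Sum>y\<in>carrier_vec n. of_real (pmf p y) * ((\<Sum>w\<in>?A. eval_char n w x * cnj (eval_char n w y)) / ?N))"
    unfolding pmf_plus_uniform[OF assms] of_real_sum of_real_mult
    by (intro sum.cong refl arg_cong2[of _ _ _ _ "(*)"] ind)
  also have "\<dots> = (\<Sum>y\<in>carrier_vec n. \<Sum>w\<in>?A. eval_char n w x * cnj (of_real (pmf p y) * eval_char n w y)) / ?N"
    by (simp add: sum_divide_distrib sum_distrib_left mult_ac)
  also have "(\<Sum>y\<in>carrier_vec n. \<Sum>w\<in>?A. eval_char n w x * cnj (of_real (pmf p y) * eval_char n w y)) =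
     (\<Sum>w\<in>?A. \<Sum>y\<in>carrier_vec n. eval_char n w x * cnj (of_real (pmf p y) * eval_char n w y))"
    by (rule sum.swap)
  also have "\<dots> = (\<Sum>w\<in>?A. eval_char n w x * cnj (fourier n p w))"
    by (simp only: fourier_def cnj_sum sum_distrib_left)
  finally show ?thesis .
qed

lemma fourier_trivial:
  assumes "set_pmf p \<subseteq> carrier_vec n"
  shows "fourier n p (trivial_char_vec n) = 1"
proof -
  have "(\<Sum>y\<in>carrier_vec n. pmf p y) = 1"
    using assms by (intro sum_pmf_eq_1 finite_carrier_vec)
  then show ?thesis by (simp add: fourier_def flip: of_real_sum)
qed

lemma fourier_uniform:
  fixes w :: "nat \<Rightarrow> 'a::{finite,comm_ring_1} \<Rightarrow> complex"
  assumes "w \<in> char_vecs n" "w \<noteq> trivial_char_vec n"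
  shows "fourier n (pmf_of_set (carrier_vec n)) w = 0"
proof -
  have ne: "carrier_vec n \<noteq> ({} :: 'a vec set)" using zero_carrier_vec by blast
  have "fourier n (pmf_of_set (carrier_vec n)) w =
     (\<Sum>y\<in>carrier_vec n. of_real (1 / real (card (carrier_vec n :: 'a vec set))) * eval_char n w y)"
    unfolding fourier_def by (intro sum.cong refl) (simp add: ne finite_carrier_vec)
  also have "\<dots> = 0"
    unfolding sum_distrib_left[symmetric] sum_eval_char[OF assms(1)] using assms(2) by simp
  finally show ?thesis .
qed

lemma tv_dist_le_sum:
  fixes p q :: "'b pmf"
  assumes fin: "finite S" and sub: "set_pmf p \<subseteq> S" "set_pmf q \<subseteq> S"
  shows "tv_dist p q \<le> (\<Sum>x\<in>S. \<bar>pmf p x - pmf q x\<bar>)"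
  unfolding tv_dist_def
proof (rule cSUP_least)
  fix A :: "'b set"
  have eq: "measure_pmf.prob r A = (\<Sum>x\<in>S \<inter> A. pmf r x)" if "set_pmf r \<subseteq> S" for r
  proof -
    have "measure_pmf.prob r A = measure_pmf.prob r (S \<inter> A)"
      using that by (intro measure_pmf.finite_measure_eq_AE) (auto simp: AE_measure_pmf_iff)
    then show ?thesis using fin by (simp add: measure_measure_pmf_finite)
  qed
  have "\<bar>measure_pmf.prob p A - measure_pmf.prob q A\<bar> \<le> (\<Sum>x\<in>S \<inter> A. \<bar>pmf p x - pmf q x\<bar>)"
    unfolding eq[OF sub(1)] eq[OF sub(2)] sum_subtractf[symmetric] by (rule sum_abs)
  also have "\<dots> \<le> (\<Sum>x\<in>S. \<bar>pmf p x - pmf q x\<bar>)"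
    using fin by (intro sum_mono2) auto
  finally show "\<bar>measure_pmf.prob p A - measure_pmf.prob q A\<bar> \<le> (\<Sum>x\<in>S. \<bar>pmf p x - pmf q x\<bar>)" .
qed simp

lemma set_plus_uniform_subset:
  fixes p :: "'a::{finite,comm_ring_1} vec pmf"
  assumes "set_pmf p \<subseteq> carrier_vec n" "add_subgroup n B"
  shows "set_pmf (plus_uniform p B) \<subseteq> carrier_vec n"
proof -
  have "B \<subseteq> carrier_vec n" "B \<noteq> {}" using assms(2) by (auto simp: add_subgroup_def)
  moreover from this have "finite B" using finite_subset finite_carrier_vec by blast
  ultimately have "set_pmf (plus_uniform p B) = (\<lambda>(x, y). x + y) ` (set_pmf p \<times> B)"
    by (simp add: plus_uniform_def)
  then show ?thesis using assms(1) \<open>B \<subseteq> carrier_vec n\<close> by (auto intro!: add_carrier_vec)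
qed

text \<open>
  The laws of the two sums have the same Fourier coefficient 1 at the trivial character. At the
  other characters the coefficients of the uniform law vanish, so Fourier inversion bounds the
  difference of the two densities at each point.
\<close>

lemma tv_plus_uniform_le:
  fixes p :: "'a::{finite,comm_ring_1} vec pmf"
  assumes p: "set_pmf p \<subseteq> carrier_vec n" and B: "add_subgroup n B"
  shows "tv_dist (plus_uniform p B) (plus_uniform (pmf_of_set (carrier_vec n)) B)
     \<le> (\<Sum>w\<in>annihilator n B - {trivial_char_vec n}. norm (fourier n p w))"
proof -
  let ?A = "annihilator n B" and ?t = "trivial_char_vec n" and ?N = "real (CARD('a) ^ n)"
  let ?u = "pmf_of_set (carrier_vec n :: 'a vec set)"
  let ?P = "plus_uniform p B" and ?Q = "plus_uniform ?u B"
  have ne: "carrier_vec n \<noteq> ({} :: 'a vec set)" using zero_carrier_vec by blast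
  then have u: "set_pmf ?u \<subseteq> carrier_vec n" by (simp add: finite_carrier_vec)
  have diff: "\<bar>pmf ?P x - pmf ?Q x\<bar> \<le> (\<Sum>w\<in>?A - {?t}. norm (fourier n p w)) / ?N"
    if x: "x \<in> carrier_vec n" for x
  proof -
    let ?f = "\<lambda>w. eval_char n w x * cnj (fourier n p w - fourier n ?u w)"
    have "complex_of_real (pmf ?P x - pmf ?Q x) = (\<Sum>w\<in>?A. ?f w) / of_nat (CARD('a) ^ n)"
      unfolding of_real_diff pmf_plus_uniform_fourier[OF p B x] pmf_plus_uniform_fourier[OF u B x]
      by (simp add: diff_divide_distrib sum_subtractf right_diff_distrib)
    also have "(\<Sum>w\<in>?A. ?f w) = (\<Sum>w\<in>?A - {?t}. ?f w)"
      by (rule sum.mono_neutral_right)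
         (auto simp: finite_annihilator fourier_trivial[OF p] fourier_trivial[OF u])
    also have "\<dots> = (\<Sum>w\<in>?A - {?t}. eval_char n w x * cnj (fourier n p w))"
      by (intro sum.cong refl) (simp add: fourier_uniform annihilator_def)
    finally have F: "complex_of_real (pmf ?P x - pmf ?Q x) =
        (\<Sum>w\<in>?A - {?t}. eval_char n w x * cnj (fourier n p w)) / of_nat (CARD('a) ^ n)" .
    have "\<bar>pmf ?P x - pmf ?Q x\<bar> = norm (complex_of_real (pmf ?P x - pmf ?Q x))"
      by (simp only: norm_of_real)
    also have "\<dots> = norm (\<Sum>w\<in>?A - {?t}. eval_char n w x * cnj (fourier n p w)) / ?N"
      unfolding F norm_divide norm_of_nat ..
    also have "\<dots> \<le> (\<Sum>w\<in>?A - {?t}. norm (eval_char n w x * cnj (fourier n p w))) / ?N"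
      by (intro divide_right_mono norm_sum) simp
    also have "\<dots> = (\<Sum>w\<in>?A - {?t}. norm (fourier n p w)) / ?N"
      by (intro arg_cong2[of _ _ _ _ "(/)"] sum.cong refl)
         (simp add: norm_mult norm_eval_char annihilator_def)
    finally show ?thesis .
  qed
  have "tv_dist ?P ?Q \<le> (\<Sum>x\<in>carrier_vec n. \<bar>pmf ?P x - pmf ?Q x\<bar>)"
    by (intro tv_dist_le_sum finite_carrier_vec set_plus_uniform_subset p u B)
  also have "\<dots> \<le> (\<Sum>x\<in>(carrier_vec n :: 'a vec set). (\<Sum>w\<in>?A - {?t}. norm (fourier n p w)) / ?N)"
    by (rule sum_mono) (rule diff)
  also have "\<dots> = (\<Sum>w\<in>?A - {?t}. norm (fourier n p w))"
    by (simp add: card_carrier_vec)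
  finally show ?thesis .
qed

section \<open>Averaging over the random matrix\<close>

lemma pmf_map_Pi_pmf:
  assumes fin: "finite A" and F: "\<And>f g. F f = F g \<longleftrightarrow> (\<forall>a\<in>A. f a = g a)"
  shows "pmf (map_pmf F (Pi_pmf A d p)) (F f) = (\<Prod>a\<in>A. pmf (p a) (f a))"
proof -
  have "F -` {F f} = Pi A (\<lambda>a. {f a})" by (auto simp: F)
  then show ?thesis
    by (simp add: pmf_map measure_Pi_pmf_Pi[OF fin] measure_pmf_single)
qed

lemma pmf_iid_vec:
  assumes "v \<in> carrier_vec n"
  shows "pmf (iid_vec n \<mu>) v = (\<Prod>i<n. pmf \<mu> (v $ i))"
proof -
  have "vec n (\<lambda>i. v $ i) = v" using assms by auto
  moreover have "pmf (iid_vec n \<mu>) (vec n (\<lambda>i. v $ i)) = (\<Prod>i<n. pmf \<mu> (v $ i))"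
    unfolding iid_vec_def
    by (rule pmf_map_Pi_pmf[where F = "vec n" and f = "\<lambda>i. v $ i"]) (auto simp: vec_eq_iff)
  ultimately show ?thesis by simp
qed

lemma set_iid_vec: "set_pmf (iid_vec n \<mu>) \<subseteq> carrier_vec n"
  by (auto simp: iid_vec_def)

definition entry_law ::
  "'a::{finite,comm_ring_1} pmf \<Rightarrow> (nat \<times> nat) set \<Rightarrow> nat \<times> nat \<Rightarrow> 'a pmf" where
  "entry_law \<mu> E ij = (if ij \<in> E then pmf_of_set UNIV else \<mu>)"

lemma pmf_random_mat:
  assumes "X \<in> carrier_mat n m"
  shows "pmf (random_mat n m \<mu> E) X = (\<Prod>ij\<in>{..<n}\<times>{..<m}. pmf (entry_law \<mu> E ij) (X $$ ij))"
proof -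
  have eq: "mat n m (\<lambda>ij. X $$ ij) = X" using assms by auto
  have "pmf (random_mat n m \<mu> E) (mat n m (\<lambda>ij. X $$ ij)) =
      (\<Prod>ij\<in>{..<n}\<times>{..<m}. pmf (entry_law \<mu> E ij) (X $$ ij))"
    unfolding random_mat_def entry_law_def[symmetric]
    by (rule pmf_map_Pi_pmf[where F = "mat n m" and f = "\<lambda>ij. X $$ ij"]) (auto simp: mat_eq_iff)
  then show ?thesis by (simp only: eq)
qed

definition char_mean :: "'a::finite pmf \<Rightarrow> ('a \<Rightarrow> complex) \<Rightarrow> complex" where
  "char_mean p f = (\<Sum>x\<in>UNIV. of_real (pmf p x) * f x)"

lemma fourier_iid_vec:
  "fourier n (iid_vec n \<mu>) w = (\<Prod>i<n. char_mean \<mu> (w i))"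
proof -
  have "fourier n (iid_vec n \<mu>) w =
      (\<Sum>v\<in>carrier_vec n. \<Prod>i<n. of_real (pmf \<mu> (v $ i)) * w i (v $ i))"
    unfolding fourier_def by (intro sum.cong refl) (simp add: pmf_iid_vec eval_char_def prod.distrib)
  also have "\<dots> = (\<Prod>i<n. char_mean \<mu> (w i))"
    unfolding char_mean_def by (rule sum_carrier_vec_prod)
  finally show ?thesis .
qed

lemma column_im_add_subgroup:
  fixes X :: "'a::comm_ring_1 mat"
  assumes X: "X \<in> carrier_mat n m"
  shows "add_subgroup n (column_im X)"
    and "\<And>j r. j < m \<Longrightarrow> r \<cdot>\<^sub>v col X j \<in> column_im X"
proof -
  interpret VM: vec_module "TYPE('a)" n .
  have cols: "set (cols X) \<subseteq> carrier_vec n" using cols_dim[of X] by (simp add: carrier_matD(1)[OF X])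
  have im: "column_im X = VM.span (set (cols X))" using X by (simp add: column_im_def)
  have sm: "LinearCombinations.submodule class_ring (column_im X) (module_vec TYPE('a) n)"
    unfolding im by (rule VM.span_is_submodule[OF cols])
  note sub = LinearCombinations.submodule.subset[OF sm, unfolded module_vec_simps]
    and add = LinearCombinations.submodule.m_closed[OF sm, unfolded module_vec_simps]
    and zero = LinearCombinations.submodule.zero_closed[OF sm, unfolded module_vec_simps]
    and smult = LinearCombinations.submodule.smult_closed[OF sm, unfolded module_vec_simps, simplified]
  have "- x \<in> column_im X" if "x \<in> column_im X" for x
  proof -
    have "- x = (- 1) \<cdot>\<^sub>v x" using sub that by (intro eq_vecI) auto
    then show ?thesis using smult[OF that] by simp
  qed
  then show "add_subgroup n (column_im X)"
    using sub add zero by (auto simp: add_subgroup_def)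
  show "r \<cdot>\<^sub>v col X j \<in> column_im X" if j: "j < m" for j r
  proof -
    have "col X j \<in> set (cols X)" using X j by (auto simp: cols_def)
    then have "col X j \<in> column_im X" using VM.in_own_span[OF cols] im by blast
    then show ?thesis by (rule smult)
  qed
qed

text \<open>
  In \<open>r\<close>, the value of \<open>w\<close> at \<open>r\<close> times a vector is an additive character of the ring, so its mean
  detects whether it is trivial. This is how the condition that \<open>w\<close> kills all multiples of a column
  becomes a product over the entries of that column.
\<close>

lemma mean_char_eq_indicator:
  fixes w :: "nat \<Rightarrow> 'a::{finite,comm_ring_1} \<Rightarrow> complex"
  assumes w: "w \<in> char_vecs n"
  shows "(\<Sum>r\<in>UNIV. eval_char n w (vec n (\<lambda>i. r * x i))) / of_nat CARD('a) =
     (if \<forall>r. eval_char n w (vec n (\<lambda>i. r * x i)) = 1 then 1 else 0)"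
proof -
  have "(\<lambda>r. eval_char n w (vec n (\<lambda>i. r * x i))) \<in> chars"
    unfolding chars_def
  proof safe
    show "eval_char n w (vec n (\<lambda>i. 0 * x i)) = 1"
      by (simp add: eval_char_def chars_zero[OF char_vecs_nth[OF w]])
    fix r s
    have "vec n (\<lambda>i. (r + s) * x i) = vec n (\<lambda>i. r * x i) + vec n (\<lambda>i. s * x i)"
      by (auto simp: distrib_right)
    then show "eval_char n w (vec n (\<lambda>i. (r + s) * x i)) =
       eval_char n w (vec n (\<lambda>i. r * x i)) * eval_char n w (vec n (\<lambda>i. s * x i))"
      by (simp add: eval_char_add[OF w])
  qed
  from sum_chars[OF this] show ?thesis by (auto simp: fun_eq_iff)
qed

text \<open>
  Only the multiples of the columns are used: that \<open>w\<close> kills all of them is necessary for it to kill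
  the image. The indicator of this event is a product over the columns of means over \<open>r\<close>; after
  expanding this product into a sum over one multiplier \<open>\<rho> j\<close> for each column, each term is a product of
  functions of single entries, whose expectation factorises by independence.
\<close>

lemma prob_annihilates_le:
  fixes w :: "nat \<Rightarrow> 'a::{finite,comm_ring_1} \<Rightarrow> complex"
  assumes w: "w \<in> char_vecs n"
  shows "(\<Sum>X\<in>carrier_mat n m. pmf (random_mat n m \<mu> E) X * of_bool (w \<in> annihilator n (column_im X)))
    \<le> (\<Prod>j<m. (\<Sum>r\<in>UNIV. \<Prod>i<n. norm (char_mean (entry_law \<mu> E (i, j)) (\<lambda>x. w i (r * x)))) / real CARD('a))"
proof -
  let ?q = "of_nat CARD('a) :: complex"
  let ?kills = "\<lambda>X j. \<forall>r. eval_char n w (vec n (\<lambda>i. r * X $$ (i, j))) = 1"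
  let ?p = "\<lambda>X. pmf (random_mat n m \<mu> E) X"
  let ?S = "\<Sum>X\<in>carrier_mat n m. ?p X * (\<Prod>j<m. of_bool (?kills X j))"
  let ?c = "\<lambda>i j r. char_mean (entry_law \<mu> E (i, j)) (\<lambda>x. w i (r * x))"
  have "(\<Sum>X\<in>carrier_mat n m. ?p X * of_bool (w \<in> annihilator n (column_im X))) \<le> ?S"
  proof (intro sum_mono mult_left_mono)
    fix X :: "'a mat" assume X: "X \<in> carrier_mat n m"
    have "?kills X j" if ann: "w \<in> annihilator n (column_im X)" and j: "j < m" for j
    proof
      fix r
      have "vec n (\<lambda>i. r * X $$ (i, j)) = r \<cdot>\<^sub>v col X j" using X j by (intro eq_vecI) auto
      then show "eval_char n w (vec n (\<lambda>i. r * X $$ (i, j))) = 1"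
        using ann column_im_add_subgroup(2)[OF X j] by (simp add: annihilator_def)
    qed
    then show "of_bool (w \<in> annihilator n (column_im X)) \<le> (\<Prod>j<m. of_bool (?kills X j) :: real)"
      by (cases "w \<in> annihilator n (column_im X)") (auto intro!: prod_nonneg)
  qed simp
  also have "?S = norm (complex_of_real ?S)"
    unfolding norm_of_real by (intro abs_of_nonneg[symmetric] sum_nonneg mult_nonneg_nonneg prod_nonneg) auto
  also have "complex_of_real ?S =
      (\<Sum>X\<in>carrier_mat n m. of_real (?p X) *
         (\<Prod>j<m. (\<Sum>r\<in>UNIV. eval_char n w (vec n (\<lambda>i. r * X $$ (i, j)))) / ?q))"
    unfolding of_real_sum of_real_mult of_real_prod mean_char_eq_indicator[OF w]
    by (intro sum.cong arg_cong2[of _ _ _ _ "(*)"] prod.cong refl) auto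
  also have "\<dots> = (\<Sum>X\<in>carrier_mat n m. (\<Sum>\<rho>\<in>PiE {..<m} (\<lambda>_. UNIV).
      (\<Prod>j<m. \<Prod>i<n. of_real (pmf (entry_law \<mu> E (i, j)) (X $$ (i, j))) * w i (\<rho> j * X $$ (i, j))))
      / ?q ^ m)"
  proof (intro sum.cong refl)
    fix X :: "'a mat" assume X: "X \<in> carrier_mat n m"
    have P: "?p X = (\<Prod>j<m. \<Prod>i<n. pmf (entry_law \<mu> E (i, j)) (X $$ (i, j)))"
      unfolding pmf_random_mat[OF X] prod.cartesian_product'
      by (rule prod.swap)
    have "(\<Prod>j<m. (\<Sum>r\<in>UNIV. eval_char n w (vec n (\<lambda>i. r * X $$ (i, j)))) / ?q) =
        (\<Prod>j<m. \<Sum>r\<in>UNIV. \<Prod>i<n. w i (r * X $$ (i, j))) / ?q ^ m"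
      by (simp add: prod_dividef eval_char_def)
    also have "(\<Prod>j<m. \<Sum>r\<in>UNIV. \<Prod>i<n. w i (r * X $$ (i, j))) =
       (\<Sum>\<rho>\<in>PiE {..<m} (\<lambda>_. UNIV). \<Prod>j<m. \<Prod>i<n. w i (\<rho> j * X $$ (i, j)))"
      by (rule prod_sum_PiE) auto
    finally show "of_real (?p X) * (\<Prod>j<m. (\<Sum>r\<in>UNIV. eval_char n w (vec n (\<lambda>i. r * X $$ (i, j)))) / ?q) =
       (\<Sum>\<rho>\<in>PiE {..<m} (\<lambda>_. UNIV).
      (\<Prod>j<m. \<Prod>i<n. of_real (pmf (entry_law \<mu> E (i, j)) (X $$ (i, j))) * w i (\<rho> j * X $$ (i, j))))
      / ?q ^ m"
      by (simp only: P of_real_prod prod.distrib sum_distrib_left times_divide_eq_right)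
  qed
  also have "\<dots> = (\<Sum>\<rho>\<in>PiE {..<m} (\<lambda>_. UNIV). \<Sum>X\<in>carrier_mat n m.
      \<Prod>j<m. \<Prod>i<n. of_real (pmf (entry_law \<mu> E (i, j)) (X $$ (i, j))) * w i (\<rho> j * X $$ (i, j))) / ?q ^ m"
    unfolding sum_divide_distrib[symmetric] by (subst sum.swap) (rule refl)
  also have "\<dots> = (\<Sum>\<rho>\<in>PiE {..<m} (\<lambda>_. UNIV). \<Prod>j<m. \<Prod>i<n. ?c i j (\<rho> j)) / ?q ^ m"
  proof (intro arg_cong2[of _ _ _ _ "(/)"] sum.cong refl)
    fix \<rho> :: "nat \<Rightarrow> 'a"
    let ?h = "\<lambda>(i, j) x. complex_of_real (pmf (entry_law \<mu> E (i, j)) x) * w i (\<rho> j * x)"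
    have pair: "(\<Prod>j<m. \<Prod>i<n. g i j) = (\<Prod>ij\<in>{..<n}\<times>{..<m}. case ij of (i, j) \<Rightarrow> g i j)"
      for g :: "nat \<Rightarrow> nat \<Rightarrow> complex"
      unfolding prod.cartesian_product[symmetric] by (rule prod.swap)
    have "(\<Sum>X\<in>carrier_mat n m. \<Prod>j<m. \<Prod>i<n.
           complex_of_real (pmf (entry_law \<mu> E (i, j)) (X $$ (i, j))) * w i (\<rho> j * X $$ (i, j)))
        = (\<Sum>X\<in>carrier_mat n m. \<Prod>ij\<in>{..<n}\<times>{..<m}. ?h ij (X $$ ij))"
      unfolding pair by (intro sum.cong prod.cong refl) auto
    also have "\<dots> = (\<Prod>ij\<in>{..<n}\<times>{..<m}. \<Sum>x\<in>UNIV. ?h ij x)"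
      by (rule sum_carrier_mat_prod)
    also have "\<dots> = (\<Prod>j<m. \<Prod>i<n. ?c i j (\<rho> j))"
      unfolding pair char_mean_def by (intro prod.cong refl) auto
    finally show "(\<Sum>X\<in>carrier_mat n m. \<Prod>j<m. \<Prod>i<n.
           complex_of_real (pmf (entry_law \<mu> E (i, j)) (X $$ (i, j))) * w i (\<rho> j * X $$ (i, j)))
        = (\<Prod>j<m. \<Prod>i<n. ?c i j (\<rho> j))" .
  qed
  also have "(\<Sum>\<rho>\<in>PiE {..<m} (\<lambda>_. UNIV). \<Prod>j<m. \<Prod>i<n. ?c i j (\<rho> j)) =
      (\<Prod>j<m. \<Sum>r\<in>UNIV. \<Prod>i<n. ?c i j r)"
    by (rule prod_sum_PiE[symmetric]) auto
  also have "norm ((\<Prod>j<m. \<Sum>r\<in>UNIV. \<Prod>i<n. ?c i j r) / ?q ^ m) =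
      (\<Prod>j<m. norm (\<Sum>r\<in>UNIV. \<Prod>i<n. ?c i j r) / real CARD('a))"
    by (simp add: norm_divide norm_power prod_dividef prod_norm)
  also have "\<dots> \<le> (\<Prod>j<m. (\<Sum>r\<in>UNIV. \<Prod>i<n. norm (?c i j r)) / real CARD('a))"
    by (intro prod_mono conjI divide_right_mono divide_nonneg_nonneg)
       (auto simp: prod_norm intro: norm_sum)
  finally show ?thesis .
qed

text \<open>
  The union bound over characters: a nontrivial \<open>w\<close> contributes its Fourier coefficient to the distance
  only when it is trivial on the image of the matrix.
\<close>

lemma mean_tv_le:
  fixes \<mu> :: "'a::{finite,comm_ring_1} pmf"
  shows "mean_tv n m \<mu> E \<le> (\<Sum>w\<in>char_vecs n - {trivial_char_vec n}.
     (\<Prod>i<n. norm (char_mean \<mu> (w i))) *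
     (\<Prod>j<m. (\<Sum>r\<in>UNIV. \<Prod>i<n. norm (char_mean (entry_law \<mu> E (i, j)) (\<lambda>x. w i (r * x)))) / real CARD('a)))"
proof -
  let ?W = "char_vecs n - {trivial_char_vec n} :: (nat \<Rightarrow> 'a \<Rightarrow> complex) set"
  let ?p = "\<lambda>X. pmf (random_mat n m \<mu> E) X"
  have "mean_tv n m \<mu> E \<le> (\<Sum>X\<in>carrier_mat n m. ?p X *
      (\<Sum>w\<in>annihilator n (column_im X) - {trivial_char_vec n}. norm (fourier n (iid_vec n \<mu>) w)))"
    unfolding mean_tv_def
    by (intro sum_mono mult_left_mono tv_plus_uniform_le set_iid_vec column_im_add_subgroup(1)) auto
  also have "\<dots> = (\<Sum>X\<in>carrier_mat n m. \<Sum>w\<in>?W. norm (fourier n (iid_vec n \<mu>) w) *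
      (?p X * of_bool (w \<in> annihilator n (column_im X))))"
  proof (intro sum.cong refl)
    fix X :: "'a mat"
    have "(\<Sum>w\<in>annihilator n (column_im X) - {trivial_char_vec n}. norm (fourier n (iid_vec n \<mu>) w)) =
       (\<Sum>w\<in>?W. norm (fourier n (iid_vec n \<mu>) w) * of_bool (w \<in> annihilator n (column_im X)))"
      by (rule sum.mono_neutral_cong_left) (auto simp: annihilator_def finite_char_vecs)
    then show "?p X * (\<Sum>w\<in>annihilator n (column_im X) - {trivial_char_vec n}. norm (fourier n (iid_vec n \<mu>) w)) =
       (\<Sum>w\<in>?W. norm (fourier n (iid_vec n \<mu>) w) *
      (?p X * of_bool (w \<in> annihilator n (column_im X))))"
      by (simp add: sum_distrib_left mult_ac)
  qed
  also have "\<dots> = (\<Sum>w\<in>?W. norm (fourier n (iid_vec n \<mu>) w) *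
      (\<Sum>X\<in>carrier_mat n m. ?p X * of_bool (w \<in> annihilator n (column_im X))))"
    by (subst sum.swap) (simp only: sum_distrib_left)
  also have "\<dots> \<le> (\<Sum>w\<in>?W. norm (fourier n (iid_vec n \<mu>) w) *
      (\<Prod>j<m. (\<Sum>r\<in>UNIV. \<Prod>i<n. norm (char_mean (entry_law \<mu> E (i, j)) (\<lambda>x. w i (r * x)))) / real CARD('a)))"
    by (intro sum_mono mult_left_mono prob_annihilates_le) auto
  finally show ?thesis by (simp add: fourier_iid_vec prod_norm)
qed

section \<open>Characters that are not constant on the support\<close>

definition const_chars :: "'a::{finite,comm_ring_1} pmf \<Rightarrow> ('a \<Rightarrow> complex) set" where
  "const_chars \<mu> = {f \<in> chars. \<forall>x\<in>set_pmf \<mu>. \<forall>y\<in>set_pmf \<mu>. f x = f y}"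

lemma sum_pmf_UNIV: "(\<Sum>x\<in>UNIV. pmf p x) = (1::real)" for p :: "'a::finite pmf"
  by (rule sum_pmf_eq_1) auto

lemma norm_char_mean_le_1:
  fixes p :: "'a::{finite,comm_ring_1} pmf"
  assumes "f \<in> chars"
  shows "norm (char_mean p f) \<le> 1"
proof -
  have "norm (char_mean p f) \<le> (\<Sum>x\<in>UNIV. norm (of_real (pmf p x) * f x))"
    unfolding char_mean_def by (rule norm_sum)
  also have "\<dots> = 1" by (simp add: norm_mult norm_chars[OF assms] sum_pmf_UNIV)
  finally show ?thesis .
qed

text \<open>
  The variance of a random variable with values on the unit circle. It is positive unless the
  variable is constant, so the mean then lies strictly inside the circle.
\<close>

lemma char_mean_variance:
  fixes p :: "'a::{finite,comm_ring_1} pmf"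
  assumes "f \<in> chars"
  shows "(\<Sum>x\<in>UNIV. pmf p x * (norm (f x - char_mean p f))\<^sup>2) = 1 - (norm (char_mean p f))\<^sup>2"
proof -
  let ?S = "char_mean p f"
  have sq: "(norm (f x - ?S))\<^sup>2 = 1 + (norm ?S)\<^sup>2 - 2 * Re (f x * cnj ?S)" for x
  proof -
    have "(norm (f x - ?S))\<^sup>2 = (norm (f x))\<^sup>2 + (norm ?S)\<^sup>2 - 2 * Re (f x * cnj ?S)"
      unfolding cmod_power2 by (simp add: power2_eq_square algebra_simps)
    then show ?thesis by (simp add: norm_chars[OF assms])
  qed
  have "(\<Sum>x\<in>UNIV. pmf p x * (norm (f x - ?S))\<^sup>2) =
      (1 + (norm ?S)\<^sup>2) * (\<Sum>x\<in>UNIV. pmf p x) - 2 * (\<Sum>x\<in>UNIV. pmf p x * Re (f x * cnj ?S))"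
    unfolding sq sum_distrib_left sum_subtractf[symmetric]
    by (intro sum.cong refl) (simp add: algebra_simps)
  also have "(\<Sum>x\<in>UNIV. pmf p x * Re (f x * cnj ?S)) = Re (?S * cnj ?S)"
    unfolding char_mean_def sum_distrib_right Re_sum by (intro sum.cong refl) (simp add: algebra_simps)
  also have "Re (?S * cnj ?S) = (norm ?S)\<^sup>2"
    unfolding cmod_power2 by (simp add: power2_eq_square)
  finally show ?thesis by (simp add: sum_pmf_UNIV)
qed

lemma norm_char_mean_less_1:
  fixes p :: "'a::{finite,comm_ring_1} pmf"
  assumes f: "f \<in> chars" and "f \<notin> const_chars p"
  shows "norm (char_mean p f) < 1"
proof (rule ccontr)
  assume "\<not> norm (char_mean p f) < 1"
  then have "(norm (char_mean p f))\<^sup>2 \<ge> 1" using one_le_power by fastforce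
  then have "(\<Sum>x\<in>UNIV. pmf p x * (norm (f x - char_mean p f))\<^sup>2) \<le> 0"
    using char_mean_variance[OF f, of p] by linarith
  moreover have "(\<Sum>x\<in>UNIV. pmf p x * (norm (f x - char_mean p f))\<^sup>2) \<ge> 0"
    by (intro sum_nonneg) auto
  ultimately have "(\<Sum>x\<in>UNIV. pmf p x * (norm (f x - char_mean p f))\<^sup>2) = 0"
    by (rule antisym)
  then have "pmf p x * (norm (f x - char_mean p f))\<^sup>2 = 0" for x
    by (subst (asm) sum_nonneg_eq_0_iff) auto
  then have "f x = char_mean p f" if "x \<in> set_pmf p" for x
    using that by (force simp: set_pmf_iff)
  then show False using assms by (auto simp: const_chars_def)
qed

text \<open>
  The same gap serves for a uniform entry: a character that is not constant on the support of
  \<open>\<mu>\<close> is nontrivial, and its mean over the whole ring is 0. This is why replacing entries by uniform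
  ones does no harm.
\<close>

lemma uniform_char_mean_gap:
  fixes \<mu> :: "'a::{finite,comm_ring_1} pmf"
  shows "\<exists>\<rho>. 0 < \<rho> \<and> \<rho> < 1 \<and>
    (\<forall>E ij f. f \<in> chars \<longrightarrow> norm (char_mean (entry_law \<mu> E ij) f) \<le> (if f \<in> const_chars \<mu> then 1 else \<rho>))"
proof -
  \<comment> \<open>the value 1/2 keeps the maximum positive and defined when no such character exists\<close>
  let ?V = "insert (1/2) ((\<lambda>f. norm (char_mean \<mu> f)) ` (chars - const_chars \<mu>))"
  define \<rho> where "\<rho> = Max ?V"
  have fin: "finite ?V" using finite_chars by auto
  have "\<rho> \<in> ?V" unfolding \<rho>_def by (intro Max_in fin) auto
  then have "\<rho> < 1" using norm_char_mean_less_1 by auto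
  have half: "1/2 \<le> \<rho>" unfolding \<rho>_def by (intro Max_ge fin) auto
  have bd: "norm (char_mean (entry_law \<mu> E ij) f) \<le> (if f \<in> const_chars \<mu> then 1 else \<rho>)"
    if f: "f \<in> chars" for E ij f
  proof (cases "f \<in> const_chars \<mu>")
    case True
    then show ?thesis using norm_char_mean_le_1[OF f] by simp
  next
    case False
    show ?thesis
    proof (cases "ij \<in> E")
      case True
      have "f \<noteq> (\<lambda>_. 1)" using False f by (auto simp: const_chars_def)
      then have "(\<Sum>x\<in>UNIV. f x) = 0" using sum_chars[OF f] by simp
      then have "char_mean (pmf_of_set UNIV) f = 0"
        by (simp add: char_mean_def pmf_of_set sum_divide_distrib[symmetric])
      then show ?thesis using False True half by (simp add: entry_law_def)
    next
      case nE: False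
      have "norm (char_mean \<mu> f) \<le> \<rho>"
        unfolding \<rho>_def using False f by (intro Max_ge fin) auto
      then show ?thesis using False nE by (simp add: entry_law_def)
    qed
  qed
  show ?thesis
    by (intro exI[of _ \<rho>] conjI allI impI bd) (use half \<open>\<rho> < 1\<close> in auto)
qed

section \<open>The size inequality for subgroups of characters\<close>

lemma prob_eq_1_if: "set_pmf p \<subseteq> A \<Longrightarrow> measure_pmf.prob p A = 1"
  by (subst measure_pmf.prob_eq_1) (auto simp: AE_measure_pmf_iff)

text \<open>
  Among the finitely many proper ideals containing \<open>a\<close>, of which the principal ideal of \<open>a\<close> is one,
  one of maximal cardinality is maximal.
\<close>

lemma nonunit_in_maximalideal:
  fixes a :: "'a::{finite,comm_ring_1}"
  assumes "\<not> a dvd 1"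
  shows "\<exists>M. maximalideal M (class_ring :: 'a ring) \<and> a \<in> M"
proof -
  let ?R = "class_ring :: 'a ring"
  let ?J = "{J. ideal J ?R \<and> a \<in> J \<and> J \<noteq> UNIV}"
  let ?P = "cgenideal ?R a"
  have "ideal ?P ?R" by (rule cring.cgenideal_ideal[OF class_cring.is_cring]) simp
  moreover have "a \<in> ?P" by (auto simp: cgenideal_def intro!: exI[of _ "1 :: 'a"])
  moreover have "1 \<notin> ?P"
  proof
    assume "1 \<in> ?P"
    then obtain x where "1 = x * a" by (auto simp: cgenideal_def)
    then show False using assms by (metis dvd_triv_right)
  qed
  ultimately have ne: "?P \<in> ?J" by auto
  define M where "M = (ARG_MAX card J. J \<in> ?J)"
  have M: "M \<in> ?J" and max: "card J \<le> card M" if "J \<in> ?J" for J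
  proof -
    have "\<forall>J. J \<in> ?J \<longrightarrow> card J < Suc CARD('a)" by (simp add: card_mono le_imp_less_Suc)
    from arg_max_nat_lemma[of "\<lambda>J. J \<in> ?J", OF ne this]
    show "M \<in> ?J" "card J \<le> card M" using that unfolding M_def by blast+
  qed
  note M = M[OF ne]
  have "maximalideal M ?R"
  proof (rule maximalidealI)
    show "ideal M ?R" "carrier ?R \<noteq> M" using M by auto
    fix J assume J: "ideal J ?R" "M \<subseteq> J" "J \<subseteq> carrier ?R"
    show "J = M \<or> J = carrier ?R"
    proof (rule disjCI)
      assume "J \<noteq> carrier ?R"
      then have "J \<in> ?J" using J M by auto
      then have "card J \<le> card M" by (rule max)
      then show "J = M" using J(2) by (metis card_seteq finite)
    qed
  qed
  then show ?thesis using M by blast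
qed

text \<open>
  Otherwise all differences of points of the support would be nonunits and hence lie in the unique
  maximal ideal, and \<open>\<mu>\<close> would be concentrated on a translate of it.
\<close>

lemma exists_unit_difference:
  fixes \<mu> :: "'a::{finite,comm_ring_1} pmf"
  assumes loc: "local_ring TYPE('a)" and "not_on_ideal_translate \<mu>"
  shows "\<exists>x\<in>set_pmf \<mu>. \<exists>y\<in>set_pmf \<mu>. (x - y) dvd 1"
proof -
  obtain M where M: "maximalideal M (class_ring :: 'a ring)"
    and uniq: "\<And>M'. maximalideal M' (class_ring :: 'a ring) \<Longrightarrow> M' = M"
    using loc by (auto simp: local_ring_def)
  obtain y where y: "y \<in> set_pmf \<mu>" using set_pmf_not_empty[of \<mu>] by blast
  have "ideal M (class_ring :: 'a ring)" "M \<noteq> UNIV"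
    using M maximalideal.I_notcarr[OF M] by (auto simp: maximalideal_def)
  then have "measure_pmf.prob \<mu> ((\<lambda>x. y + x) ` M) \<noteq> 1"
    using assms(2) by (simp add: not_on_ideal_translate_def)
  then have "\<not> set_pmf \<mu> \<subseteq> (\<lambda>x. y + x) ` M"
    using prob_eq_1_if[of \<mu> "(\<lambda>x. y + x) ` M"] by argo
  then obtain x where x: "x \<in> set_pmf \<mu>" "x \<notin> (\<lambda>x. y + x) ` M" by auto
  have "x - y \<notin> M"
  proof
    assume "x - y \<in> M"
    then have "y + (x - y) \<in> (\<lambda>x. y + x) ` M" by (rule imageI)
    then show False using x(2) by simp
  qed
  then have "(x - y) dvd 1" using nonunit_in_maximalideal[of "x - y"] uniq by auto
  then show ?thesis using x(1) y by auto
qed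

definition stable_chars ::
  "'a::{finite,comm_ring_1} pmf \<Rightarrow> 'a set \<Rightarrow> ('a \<Rightarrow> complex) set" where
  "stable_chars \<mu> N = {f \<in> chars. \<forall>r\<in>N. (\<lambda>x. f (r * x)) \<in> const_chars \<mu>}"

lemma const_chars_mult:
  assumes "f \<in> const_chars \<mu>" "g \<in> const_chars \<mu>"
  shows "(\<lambda>x. f x * g x) \<in> const_chars \<mu>"
proof -
  have "f x * g x = f y * g y" if "x \<in> set_pmf \<mu>" "y \<in> set_pmf \<mu>" for x y
  proof -
    have "f x = f y" "g x = g y" using assms that unfolding const_chars_def by blast+
    then show ?thesis by simp
  qed
  moreover have "(\<lambda>x. f x * g x) \<in> chars"
    using assms by (intro chars_mult) (simp_all add: const_chars_def)
  ultimately show ?thesis unfolding const_chars_def by blast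
qed

lemma stable_chars_subgroup: "char_subgroup (stable_chars \<mu> N)"
  unfolding char_subgroup_def
proof (intro conjI ballI)
  show "stable_chars \<mu> N \<subseteq> chars" by (simp add: stable_chars_def)
  show "(\<lambda>_. 1) \<in> stable_chars \<mu> N" by (simp add: stable_chars_def const_chars_def)
  fix f g assume "f \<in> stable_chars \<mu> N" "g \<in> stable_chars \<mu> N"
  then show "(\<lambda>x. f x * g x) \<in> stable_chars \<mu> N"
    by (simp add: stable_chars_def chars_mult const_chars_mult)
qed

text \<open>
  This is where the hypotheses on \<open>\<mu>\<close> are used. Let \<open>L = stable_chars \<mu> N\<close>, let \<open>K\<close> be the subgroup of
  the ring killed by \<open>L\<close>, and let \<open>a\<close> be a unit that is a difference of two points of the support.
  For \<open>r \<in> N\<close> all products of \<open>r\<close> with such differences lie in \<open>K\<close>. In particular \<open>N a \<subseteq> K\<close>, so that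
  \<open>N\<close> is at most as large as \<open>K\<close>, whose cardinality times that of \<open>L\<close> is the cardinality of the ring.

  In the case of equality \<open>N a = K\<close>. Then every element of \<open>K\<close>, divided by \<open>a\<close> and multiplied by a
  difference, stays in \<open>K\<close>. The multipliers that preserve \<open>K\<close> form a subring, and \<open>\<mu>\<close> lives on an affine
  image of it; so this subring is everything and \<open>K\<close> is an ideal. If moreover \<open>1 \<in> N\<close>, then \<open>K\<close>
  contains the unit \<open>a\<close>.
\<close>

lemma stable_chars_card:
  fixes \<mu> :: "'a::{finite,comm_ring_1} pmf"
  assumes loc: "local_ring TYPE('a)" and idl: "not_on_ideal_translate \<mu>"
    and sbr: "not_on_subring_translate \<mu>"
  shows "card (stable_chars \<mu> N) * card N \<le> CARD('a)"
    and "card (stable_chars \<mu> N) * card N = CARD('a) \<Longrightarrow> 1 \<in> N \<Longrightarrow> N = UNIV"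
proof -
  let ?L = "stable_chars \<mu> N"
  define K where "K = {x. \<forall>f\<in>?L. f x = 1}"
  have LK: "card ?L * card K = CARD('a)"
    unfolding K_def by (rule card_char_subgroup_annihilator[OF stable_chars_subgroup])
  have Lc: "f \<in> chars" if "f \<in> ?L" for f using that by (simp add: stable_chars_def)
  obtain x0 y0 where xy: "x0 \<in> set_pmf \<mu>" "y0 \<in> set_pmf \<mu>" "(x0 - y0) dvd 1"
    using exists_unit_difference[OF loc idl] by blast
  define a where "a = x0 - y0"
  obtain b where b: "a * b = 1" using xy(3) unfolding a_def by (metis dvdE)
  have NK: "r * (x - y) \<in> K" if "r \<in> N" "x \<in> set_pmf \<mu>" "y \<in> set_pmf \<mu>" for r x y
    unfolding K_def
  proof safe
    fix f assume f: "f \<in> ?L"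
    have "(\<lambda>x. f (r * x)) \<in> const_chars \<mu>" using f that(1) by (simp add: stable_chars_def)
    then have "f (r * x) = f (r * y)" using that unfolding const_chars_def by blast
    moreover have "f (r * x) = f (r * (x - y)) * f (r * y)"
      using chars_add[OF Lc[OF f], of "r * (x - y)" "r * y"] by (simp add: algebra_simps)
    ultimately show "f (r * (x - y)) = 1" using chars_nonzero[OF Lc[OF f]] by simp
  qed
  have inj: "inj_on (\<lambda>r. r * a) N"
    by (rule inj_on_inverseI[where g = "\<lambda>r. r * b"]) (simp add: mult.assoc b)
  have img: "(\<lambda>r. r * a) ` N \<subseteq> K" using NK xy unfolding a_def by auto
  have NleK: "card N \<le> card K" using card_mono[OF _ img] card_image[OF inj] by simp
  then show "card ?L * card N \<le> CARD('a)" using LK by (metis mult_le_mono2)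
  assume eq: "card ?L * card N = CARD('a)" and one: "1 \<in> N"
  have "card ?L \<noteq> 0"
  proof
    assume "card ?L = 0"
    then have "CARD('a) = 0" using LK by (simp only: mult_0)
    then show False by simp
  qed
  then have "card N = card K" using LK eq by (metis mult_left_cancel)
  then have imgK: "(\<lambda>r. r * a) ` N = K"
    using card_subset_eq[OF _ img] card_image[OF inj] by simp
  define S where "S = {s. \<forall>k\<in>K. s * k \<in> K}"
  have Kadd: "x + y \<in> K" if "x \<in> K" "y \<in> K" for x y
    using that by (auto simp: K_def chars_add[OF Lc])
  have Kminus: "- x \<in> K" if "x \<in> K" for x
    using that by (auto simp: K_def chars_minus[OF Lc])
  have "subring S (class_ring :: 'a ring)"
    by (rule ring.subringI[OF class_ring.ring_axioms])
       (auto simp: S_def class_ring_simps distrib_right mult.assoc Kadd Kminus)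
  moreover have "set_pmf \<mu> \<subseteq> (\<lambda>x. y0 + a * x) ` S"
  proof
    fix x assume x: "x \<in> set_pmf \<mu>"
    have "b * (x - y0) \<in> S"
      unfolding S_def
    proof safe
      fix k assume "k \<in> K"
      then obtain r where r: "r \<in> N" "k = r * a" using imgK by blast
      have "b * (x - y0) * k = r * (x - y0) * (a * b)" by (simp add: r(2) mult_ac)
      then show "b * (x - y0) * k \<in> K" using NK[OF r(1) x xy(2)] b by simp
    qed
    moreover have "x = y0 + a * (b * (x - y0))" by (simp add: b flip: mult.assoc)
    ultimately show "x \<in> (\<lambda>x. y0 + a * x) ` S" by blast
  qed
  then have "measure_pmf.prob \<mu> ((\<lambda>x. y0 + a * x) ` S) = 1" by (rule prob_eq_1_if)
  ultimately have "S = UNIV"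
    using sbr xy(3) unfolding not_on_subring_translate_def a_def by blast
  have "a \<in> K" using img one by force
  have "K = UNIV"
  proof -
    have "x \<in> K" for x
    proof -
      have "x * b \<in> S" using \<open>S = UNIV\<close> by simp
      then have "x * b * a \<in> K" using \<open>a \<in> K\<close> by (simp add: S_def)
      then show ?thesis using b by (simp add: mult.assoc mult.commute[of b])
    qed
    then show ?thesis by blast
  qed
  then have "card N = CARD('a)" using \<open>card N = card K\<close> by simp
  then show "N = UNIV" by (metis card_subset_eq finite subset_UNIV)
qed

section \<open>Summing over tuples of characters\<close>

text \<open>
  A Chernoff bound: a word with \<open>d\<close> letters outside \<open>L\<close> is given weight \<open>t ^ d\<close>, and the total
  weight of all words is a product over the positions.
\<close>

lemma card_few_exceptions_le:
  fixes G L :: "'g set" and t s :: real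
  assumes fin: "finite G" and L: "L \<subseteq> G" and t: "0 < t" "t \<le> 1"
  shows "real (card {w \<in> PiE {..<n} (\<lambda>_. G). real (card {i \<in> {..<n}. w i \<notin> L}) \<le> s})
    \<le> t powr (- s) * (real (card L) + t * real (card G)) ^ n"
proof -
  let ?P = "PiE {..<n} (\<lambda>_. G)"
  let ?d = "\<lambda>w. card {i \<in> {..<n}. w i \<notin> L}"
  have finP: "finite ?P" using fin by (intro finite_PiE) auto
  have "real (card {w \<in> ?P. real (?d w) \<le> s}) = (\<Sum>w\<in>{w \<in> ?P. real (?d w) \<le> s}. 1)" by simp
  also have "\<dots> \<le> (\<Sum>w\<in>{w \<in> ?P. real (?d w) \<le> s}. t powr (- s) * t ^ ?d w)"
  proof (rule sum_mono)
    fix w assume "w \<in> {w \<in> ?P. real (?d w) \<le> s}"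
    then have "t powr s \<le> t powr (real (?d w))" using t by (simp add: powr_mono')
    then have "t powr s \<le> t ^ ?d w" using t by (simp add: powr_realpow)
    then show "1 \<le> t powr (- s) * t ^ ?d w" using t by (simp add: powr_minus field_simps)
  qed
  also have "\<dots> \<le> (\<Sum>w\<in>?P. t powr (- s) * t ^ ?d w)"
    using t finP by (intro sum_mono2) auto
  also have "\<dots> = t powr (- s) * (\<Sum>w\<in>?P. \<Prod>i<n. if w i \<in> L then 1 else t)"
  proof -
    have "t ^ ?d w = (\<Prod>i<n. if w i \<in> L then 1 else t)" for w
    proof -
      have "{..<n} \<inter> - {i. w i \<in> L} = {i \<in> {..<n}. w i \<notin> L}" by auto
      then show ?thesis by (simp add: prod.If_cases)
    qed
    then show ?thesis by (simp add: sum_distrib_left)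
  qed
  also have "(\<Sum>w\<in>?P. \<Prod>i<n. if w i \<in> L then 1 else t) = (\<Prod>i<n. \<Sum>f\<in>G. if f \<in> L then 1 else t)"
    by (rule prod_sum_PiE[symmetric]) (use fin in auto)
  also have "\<dots> = (\<Sum>f\<in>G. if f \<in> L then 1 else t) ^ n" by simp
  also have "(\<Sum>f\<in>G. if f \<in> L then 1 else t) = card L + t * card (G - L)"
    using fin L by (simp add: sum.If_cases Int_absorb1 Int_absorb2 Diff_eq mult.commute)
  finally have "real (card {w \<in> ?P. real (?d w) \<le> s}) \<le> t powr (- s) * (card L + t * card (G - L)) ^ n" .
  also have "\<dots> \<le> t powr (- s) * (card L + t * card G) ^ n"
    using t fin by (intro mult_left_mono power_mono add_left_mono) (auto intro: card_mono)
  finally show ?thesis .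
qed

lemma powr_less_one_pos:
  fixes x a :: real
  assumes "0 < x" "x < 1" "0 < a"
  shows "x powr a < 1"
  using powr_less_mono2[of a x 1] assms by simp

lemma sum_UN_le_sum_sum:
  fixes f :: "'b \<Rightarrow> real"
  assumes "finite I" "\<And>i. i \<in> I \<Longrightarrow> finite (A i)" "\<And>x. 0 \<le> f x"
  shows "sum f (\<Union>i\<in>I. A i) \<le> (\<Sum>i\<in>I. sum f (A i))"
  using assms(1,2)
proof (induction I rule: finite_induct)
  case (insert i I)
  have "sum f (\<Union>i\<in>insert i I. A i) = sum f (A i) + sum f (\<Union>i\<in>I. A i) - sum f (A i \<inter> (\<Union>i\<in>I. A i))"
    using insert by (simp add: sum_Un)
  also have "\<dots> \<le> sum f (A i) + sum f (\<Union>i\<in>I. A i)" using assms(3) by (simp add: sum_nonneg)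
  also have "\<dots> \<le> sum f (A i) + (\<Sum>i\<in>I. sum f (A i))" using insert by simp
  finally show ?case using insert by simp
qed simp

text \<open>
  If at most a proportion \<open>\<delta>\<close> of the positions is exceptional, the number of choices for them grows at
  an exponential rate that tends to 1 as \<open>\<delta>\<close> tends to 0, so any given exponential decay \<open>\<kappa>\<close> survives
  once \<open>\<delta>\<close> is small. The two factors of the rate are each kept below \<open>\<kappa> powr (-1/4)\<close>, the first by the
  choice of \<open>\<delta>\<close> after \<open>t\<close>, the second by the choice of \<open>t\<close>.
\<close>

lemma small_growth_rate:
  fixes \<kappa> g q \<delta>' :: real
  assumes \<kappa>: "0 < \<kappa>" "\<kappa> < 1" and g: "0 < g" and q: "0 < q" and \<delta>': "0 < \<delta>'"
  shows "\<exists>\<delta> t. 0 < \<delta> \<and> \<delta> \<le> \<delta>' \<and> 0 < t \<and> t \<le> 1 \<and> t powr (- (q * \<delta>)) * (1 + t * g) * \<kappa> \<le> sqrt \<kappa>"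
proof -
  define b where "b = \<kappa> powr (- (1/4))"
  have b1: "b > 1" unfolding b_def using powr_less_one_pos[OF \<kappa>, of "1/4"] \<kappa>
    by (simp add: powr_minus one_less_inverse_iff)
  define t where "t = min 1 ((b - 1) / g)"
  have t: "0 < t" "t \<le> 1" using b1 g by (auto simp: t_def)
  have "t * g \<le> b - 1" using g by (simp add: t_def min_mult_distrib_right)
  then have tg: "1 + t * g \<le> b" by simp
  \<comment> \<open>$1 - \ln t$ and not $-\ln t$ in the denominator, since $t$ may be 1\<close>
  define \<delta> where "\<delta> = min \<delta>' (ln b / (q * (1 - ln t)))"
  have lt: "ln t \<le> 0" and lb: "ln b > 0" using t b1 by auto
  have \<delta>: "0 < \<delta>" "\<delta> \<le> \<delta>'" using \<delta>' q lt lb by (auto simp: \<delta>_def)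
  have "\<delta> \<le> ln b / (q * (1 - ln t))" by (simp add: \<delta>_def)
  then have "\<delta> * (q * (1 - ln t)) \<le> ln b" using q lt by (subst (asm) pos_le_divide_eq) auto
  moreover have "\<delta> * (q * (- ln t)) \<le> \<delta> * (q * (1 - ln t))"
    using \<delta> q by (intro mult_left_mono) auto
  ultimately have "- (q * \<delta>) * ln t \<le> ln b" by (simp add: algebra_simps)
  then have "exp (- (q * \<delta>) * ln t) \<le> exp (ln b)" by (simp only: exp_le_cancel_iff)
  then have "exp (- (q * \<delta>) * ln t) \<le> b" using b1 by simp
  then have tp: "t powr (- (q * \<delta>)) \<le> b" using t by (simp add: powr_def)
  have "t powr (- (q * \<delta>)) * (1 + t * g) * \<kappa> \<le> b * b * \<kappa>"
    using tp tg t g \<kappa> b1 by (intro mult_right_mono mult_mono) auto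
  also have "b * b = \<kappa> powr (- (1/2))" unfolding b_def powr_add[symmetric] by simp
  also have "\<kappa> powr (- (1/2)) * \<kappa> = \<kappa> powr (- (1/2)) * \<kappa> powr 1" using \<kappa> by simp
  also have "\<dots> = \<kappa> powr (1/2)" unfolding powr_add[symmetric] by simp
  also have "\<dots> = sqrt \<kappa>" using \<kappa> by (simp add: powr_half_sqrt)
  finally show ?thesis using \<delta> t by blast
qed

text \<open>
  Changing the exponent by the fixed amount \<open>u\<close>, of either sign, costs a constant factor only.
\<close>

lemma power_shift_le:
  fixes x c :: real and u :: int
  assumes x: "0 < x" "x \<le> 1" and c: "1 \<le> c * x" and m: "int m = int n + u"
  shows "x ^ m \<le> c ^ nat \<bar>u\<bar> * x ^ n"
proof (cases "u \<ge> 0")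
  case True
  have "0 < c * x" using c by linarith
  then have "0 < c" using x by (simp add: zero_less_mult_iff)
  then have "c * x \<le> c * 1" using x by (intro mult_left_mono) auto
  then have c1: "c \<ge> 1" using c by linarith
  have "x ^ m \<le> x ^ n" using x m True by (intro power_decreasing) auto
  also have "\<dots> \<le> c ^ nat \<bar>u\<bar> * x ^ n" using x c1 by simp
  finally show ?thesis .
next
  case False
  then have n: "n = m + nat \<bar>u\<bar>" using m by linarith
  have "x ^ m * 1 \<le> x ^ m * (c * x) ^ nat \<bar>u\<bar>"
    using x c by (intro mult_left_mono one_le_power) auto
  also have "\<dots> = c ^ nat \<bar>u\<bar> * x ^ n" by (simp add: n power_add power_mult_distrib)
  finally show ?thesis by simp
qed

lemma times_power_le:
  fixes y :: real
  assumes "0 < y" "y < 1"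
  shows "real n * y ^ n \<le> 1 / (1 - y)"
proof -
  have "real n * y ^ n = (\<Sum>j<n. y ^ n)" by simp
  also have "\<dots> \<le> (\<Sum>j<n. y ^ j)" using assms by (intro sum_mono power_decreasing) auto
  also have "\<dots> \<le> 1 / (1 - y)"
    using assms by (simp add: sum_gp_strict divide_right_mono)
  finally show ?thesis .
qed

text \<open>
  An exponentially small perturbation of the base changes a power with about \<open>n\<close> factors by a bounded
  factor: \<open>n * y ^ n\<close> is bounded.
\<close>

lemma perturbed_power_le:
  fixes x y q :: real and u :: int
  assumes x: "1 / q \<le> x" "x \<le> 1" and q: "1 \<le> q" and y: "0 < y" "y < 1"
    and m: "int m = int n + u"
  shows "(x + y ^ n) ^ m \<le> q ^ nat \<bar>u\<bar> * exp (q * (1 / (1 - y) + real_of_int \<bar>u\<bar>)) * x ^ n"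
proof -
  have "0 < 1 / q" using q by simp
  then have x0: "0 < x" using x by linarith
  have xq: "1 \<le> q * x" using x q by (simp add: field_simps)
  have yn: "0 \<le> y ^ n" "y ^ n \<le> 1" using y by (auto simp: power_le_one)
  have "(x + y ^ n) ^ m \<le> (x * (1 + q * y ^ n)) ^ m"
  proof (intro power_mono)
    have "1 * y ^ n \<le> (q * x) * y ^ n" using xq yn by (intro mult_right_mono)
    then show "x + y ^ n \<le> x * (1 + q * y ^ n)" by (simp add: algebra_simps)
  qed (use x0 yn in auto)
  also have "\<dots> = x ^ m * (1 + q * y ^ n) ^ m" by (rule power_mult_distrib)
  also have "(1 + q * y ^ n) ^ m \<le> exp (q * y ^ n) ^ m"
    using q yn by (intro power_mono exp_ge_add_one_self) auto
  also have "exp (q * y ^ n) ^ m = exp (q * (real m * y ^ n))"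
    by (simp add: exp_of_nat_mult[symmetric] mult_ac)
  also have "\<dots> \<le> exp (q * (1 / (1 - y) + real_of_int \<bar>u\<bar>))"
  proof -
    have "real m \<le> real n + real_of_int \<bar>u\<bar>" using m by linarith
    then have "real m * y ^ n \<le> (real n + real_of_int \<bar>u\<bar>) * y ^ n" using yn by (intro mult_right_mono)
    also have "\<dots> = real n * y ^ n + real_of_int \<bar>u\<bar> * y ^ n" by (simp add: distrib_right)
    also have "\<dots> \<le> 1 / (1 - y) + real_of_int \<bar>u\<bar> * 1"
      using yn by (intro add_mono times_power_le y mult_left_mono) auto
    finally show ?thesis using q by simp
  qed
  finally have "(x + y ^ n) ^ m \<le> x ^ m * exp (q * (1 / (1 - y) + real_of_int \<bar>u\<bar>))"
    using x0 by simp
  also have "\<dots> \<le> (q ^ nat \<bar>u\<bar> * x ^ n) * exp (q * (1 / (1 - y) + real_of_int \<bar>u\<bar>))"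
    by (intro mult_right_mono power_shift_le[OF x0 x(2) xq m]) simp
  finally show ?thesis by (simp add: mult_ac)
qed

text \<open>
  A chain of nonempty subsets with more members than the type has elements cannot descend strictly.
\<close>

lemma decreasing_sets_repeat:
  fixes N :: "nat \<Rightarrow> 'r::finite set"
  assumes dec: "\<And>k. N (Suc k) \<subseteq> N k" and ne: "\<And>k. N k \<noteq> {}"
  shows "\<exists>k<CARD('r). N (Suc k) = N k"
proof (rule ccontr)
  assume "\<not> ?thesis"
  then have strict: "N (Suc k) \<subset> N k" if "k < CARD('r)" for k using dec that by blast
  have "card (N k) + k \<le> CARD('r)" if "k \<le> CARD('r)" for k
    using that
  proof (induction k)
    case 0
    show ?case by (simp add: card_mono)
  next
    case (Suc k)
    have "card (N (Suc k)) < card (N k)" using strict[of k] Suc by (intro psubset_card_mono) auto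
    then show ?case using Suc by linarith
  qed
  from this[of "CARD('r)"] have "card (N CARD('r)) = 0" by simp
  then show False using ne by simp
qed

text \<open>
  The rest of the estimate uses only the following data. The letters in \<open>G\<close> stand for the characters of
  the ring, \<open>e\<close> for the trivial one, the elements of \<open>'r\<close> for the ring elements, and \<open>Z r\<close> for the
  characters \<open>f\<close> for which \<open>\<lambda>x. f (r * x)\<close> is constant on the support. The last two assumptions are the
  size inequality and its case of equality.
\<close>

locale defect_system =
  fixes G :: "'g set" and Z :: "'r::finite \<Rightarrow> 'g set" and e :: 'g and one zero :: 'r and \<rho> :: real
  assumes finite_G: "finite G" and e_in: "e \<in> G" "\<And>r. e \<in> Z r"
    and Z_zero: "G \<subseteq> Z zero"
    and rho: "0 < \<rho>" "\<rho> < 1"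
    and card_le: "\<And>N. card {f \<in> G. \<forall>r\<in>N. f \<in> Z r} * card N \<le> CARD('r)"
    and card_eq: "\<And>N. card {f \<in> G. \<forall>r\<in>N. f \<in> Z r} * card N = CARD('r) \<Longrightarrow> one \<in> N \<Longrightarrow> N = UNIV"
begin

abbreviation common :: "'r set \<Rightarrow> 'g set" where
  "common N \<equiv> {f \<in> G. \<forall>r\<in>N. f \<in> Z r}"

definition defect :: "nat \<Rightarrow> (nat \<Rightarrow> 'g) \<Rightarrow> 'r \<Rightarrow> nat" where
  "defect n w r = card {i \<in> {..<n}. w i \<notin> Z r}"

definition weight :: "nat \<Rightarrow> nat \<Rightarrow> (nat \<Rightarrow> 'g) \<Rightarrow> real" where
  "weight n m w = \<rho> ^ defect n w one * ((\<Sum>r\<in>UNIV. \<rho> ^ defect n w r) / real CARD('r)) ^ m"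

text \<open>
  The multipliers for which a word has few bad positions on the scale \<open>\<delta>\<close>.
\<close>

definition small_set :: "nat \<Rightarrow> (nat \<Rightarrow> 'g) \<Rightarrow> real \<Rightarrow> 'r set" where
  "small_set n w \<delta> = {r. real (defect n w r) \<le> \<delta> * real n}"

text \<open>
  The factor that every column gains from a single nontrivial letter: at least one of the
  terms in the mean over \<open>'r\<close> is then at most \<open>\<rho>\<close> and not 1.
\<close>

definition \<kappa>\<^sub>0 :: real where "\<kappa>\<^sub>0 = 1 - (1 - \<rho>) / real CARD('r)"

abbreviation words :: "nat \<Rightarrow> (nat \<Rightarrow> 'g) set" where
  "words n \<equiv> PiE {..<n} (\<lambda>_. G) - {\<lambda>i\<in>{..<n}. e}"

lemma q_ge_1: "real CARD('r) \<ge> 1"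
  by (simp add: Suc_le_eq)

lemma kappa0: "0 < \<kappa>\<^sub>0" "\<kappa>\<^sub>0 < 1" "1 - 1 / real CARD('r) \<le> \<kappa>\<^sub>0"
proof -
  have "(1 - \<rho>) / real CARD('r) \<le> 1 - \<rho>"
    using divide_left_mono[OF q_ge_1, of "1 - \<rho>"] rho by simp
  then show "0 < \<kappa>\<^sub>0" using rho unfolding \<kappa>\<^sub>0_def by linarith
  show "\<kappa>\<^sub>0 < 1" unfolding \<kappa>\<^sub>0_def using rho by simp
  show "1 - 1 / real CARD('r) \<le> \<kappa>\<^sub>0" unfolding \<kappa>\<^sub>0_def using rho by (simp add: divide_right_mono)
qed

lemma e_common: "e \<in> common N" using e_in by auto

lemma card_common_pos: "0 < card (common N)"
  using e_common finite_G by (subst card_gt_0_iff) auto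

lemma common_UNIV: "common UNIV = {e}"
proof -
  have "card (common UNIV) \<le> 1" using card_le[of UNIV] by simp
  then have "card (common UNIV) = 1" using card_common_pos[of UNIV] by linarith
  then obtain x where "common UNIV = {x}" by (rule card_1_singletonE)
  then show ?thesis using e_common[of UNIV] by simp
qed

lemma zero_small: 
  assumes "w \<in> PiE {..<n} (\<lambda>_. G)" "0 \<le> \<delta>" shows "zero \<in> small_set n w \<delta>"
proof -
  have "{i \<in> {..<n}. w i \<notin> Z zero} = {}" using assms Z_zero by auto
  then have "defect n w zero = 0" unfolding defect_def by (simp only: card.empty)
  then show ?thesis using assms by (simp add: small_set_def)
qed

lemma weight_nonneg: "0 \<le> weight n m w"
  unfolding weight_def using rho by (intro mult_nonneg_nonneg zero_le_power divide_nonneg_nonneg sum_nonneg) auto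

text \<open>
  Let \<open>N\<close> be the set of multipliers with few bad positions and \<open>l\<close> the number of letters compatible with
  all of them. The words of this kind are about \<open>l ^ n\<close> in number, so the bound has to beat \<open>(1 / l) ^ n\<close>
  by an exponential factor. A column contributes about \<open>card N / CARD('r)\<close>, which is at most \<open>1 / l\<close> by the
  size inequality. The additional factor comes from one of three sources: when the size inequality
  is strict, from the columns; when it is an equality and \<open>one \<notin> N\<close>, from the power of \<open>\<rho>\<close> in front;
  and when \<open>N = UNIV\<close>, so that \<open>l = 1\<close>, from the one nontrivial letter that the word must have.
\<close>

lemma weight_bound:
  assumes w: "w \<in> words n" and \<delta>': "0 < \<delta>'" and N: "small_set n w \<delta>' = N"
    and m: "int m = int n + u"
  shows "weight n m w \<le>
     ((1 / \<kappa>\<^sub>0) ^ nat \<bar>u\<bar> + real CARD('r) ^ nat \<bar>u\<bar> *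
        exp (real CARD('r) * (1 / (1 - \<rho> powr \<delta>') + real_of_int \<bar>u\<bar>))) *
     (max \<kappa>\<^sub>0 (\<rho> powr \<delta>') / real (card (common N))) ^ n"
    (is "_ \<le> (?C1 + ?C2) * (?\<kappa> / ?l) ^ n")
proof -
  let ?q = "real CARD('r)" and ?y = "\<rho> powr \<delta>'"
  let ?A = "(\<Sum>r\<in>UNIV. \<rho> ^ defect n w r) / ?q"
  have C: "0 \<le> ?C1" "0 \<le> ?C2" using kappa0 by auto
  have \<kappa>: "0 \<le> ?\<kappa>" using kappa0 by simp
  have rho_le1: "\<rho> ^ k \<le> 1" "0 \<le> \<rho> ^ k" for k using rho by (auto simp: power_le_one)
  have A0: "0 \<le> ?A" using rho_le1 by (intro divide_nonneg_nonneg sum_nonneg) auto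
  have wG: "w \<in> PiE {..<n} (\<lambda>_. G)" using w by simp
  show ?thesis
  proof (cases "N = UNIV")
    case True
    have "\<exists>i<n. w i \<noteq> e"
    proof (rule ccontr)
      assume "\<not> (\<exists>i<n. w i \<noteq> e)"
      then have "w = (\<lambda>i\<in>{..<n}. e)"
        using wG by (intro extensionalityI[of _ "{..<n}"]) (auto simp: PiE_iff)
      then show False using w by simp
    qed
    then obtain i where i: "i < n" "w i \<noteq> e" by blast
    then have "w i \<notin> common UNIV" using common_UNIV by simp
    then obtain r where r: "w i \<notin> Z r" using i wG by auto
    have "{i \<in> {..<n}. w i \<notin> Z r} \<noteq> {}" using i r by auto
    then have "defect n w r \<ge> 1" by (simp add: defect_def Suc_le_eq card_gt_0_iff)
    then have dr: "\<rho> ^ defect n w r \<le> \<rho>" using power_decreasing[of 1 _ \<rho>] rho by simp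
    have "(\<Sum>r\<in>UNIV. \<rho> ^ defect n w r) = \<rho> ^ defect n w r + (\<Sum>r\<in>UNIV - {r}. \<rho> ^ defect n w r)"
      by (rule sum.remove) auto
    also have "\<dots> \<le> \<rho> + (\<Sum>r\<in>UNIV - {r}. 1)"
      by (intro add_mono dr sum_mono rho_le1)
    also have "\<dots> = \<rho> + (?q - 1)" by (simp add: card_Diff_singleton of_nat_diff Suc_le_eq)
    finally have "?A \<le> (\<rho> + (?q - 1)) / ?q" by (simp add: divide_right_mono)
    also have "\<dots> = \<kappa>\<^sub>0" unfolding \<kappa>\<^sub>0_def by (simp add: field_simps)
    finally have "?A ^ m \<le> \<kappa>\<^sub>0 ^ m" using A0 by (intro power_mono)
    also have "\<dots> \<le> ?C1 * \<kappa>\<^sub>0 ^ n"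
      using kappa0 by (intro power_shift_le m) auto
    also have "\<dots> \<le> ?C1 * ?\<kappa> ^ n" using C kappa0 by (intro mult_left_mono power_mono) auto
    also have "\<dots> \<le> (?C1 + ?C2) * ?\<kappa> ^ n" using C \<kappa> by (intro mult_right_mono) auto
    finally have "?A ^ m \<le> (?C1 + ?C2) * ?\<kappa> ^ n" .
    moreover have "weight n m w \<le> 1 * ?A ^ m"
      unfolding weight_def using A0 rho_le1 by (intro mult_right_mono) auto
    ultimately show ?thesis using True common_UNIV by simp
  next
    case False
    have y: "0 < ?y" "?y < 1" using rho \<delta>' powr_less_one_pos by auto
    have big: "\<rho> ^ defect n w r \<le> ?y ^ n" if "r \<notin> N" for r
    proof -
      have "\<delta>' * real n \<le> real (defect n w r)" using that N by (auto simp: small_set_def)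
      then have "\<rho> powr real (defect n w r) \<le> \<rho> powr (\<delta>' * real n)"
        using rho by (intro powr_mono') auto
      then show ?thesis using rho by (simp add: powr_realpow powr_powr[symmetric])
    qed
    have Nne: "N \<noteq> {}" using zero_small[OF wG, of \<delta>'] N \<delta>' by auto
    define x where "x = real (card N) / ?q"
    have x: "1 / ?q \<le> x" "x \<le> 1"
    proof -
      have "1 \<le> card N" using Nne by (simp add: Suc_le_eq card_gt_0_iff)
      then show "1 / ?q \<le> x" unfolding x_def by (intro divide_right_mono) auto
      have "card N \<le> CARD('r)" by (simp add: card_mono)
      then show "x \<le> 1" unfolding x_def by (simp add: divide_le_eq_1)
    qed
    have "(\<Sum>r\<in>UNIV. \<rho> ^ defect n w r) \<le> (\<Sum>r\<in>UNIV. of_bool (r \<in> N) + ?y ^ n)"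
    proof (rule sum_mono)
      fix r show "\<rho> ^ defect n w r \<le> of_bool (r \<in> N) + ?y ^ n"
        using big[of r] rho_le1[of "defect n w r"] y by (cases "r \<in> N") (auto intro: add_increasing2)
    qed
    also have "\<dots> = card N + ?q * ?y ^ n" by (simp add: sum.distrib of_bool_def sum.If_cases)
    finally have "?A \<le> (card N + ?q * ?y ^ n) / ?q" by (simp add: divide_right_mono)
    also have "\<dots> = x + ?y ^ n" unfolding x_def by (simp add: field_simps)
    finally have "?A ^ m \<le> (x + ?y ^ n) ^ m" using A0 by (intro power_mono)
    also have "\<dots> \<le> ?C2 * x ^ n" by (rule perturbed_power_le[OF x q_ge_1 y m])
    finally have A: "?A ^ m \<le> ?C2 * x ^ n" .
    have l0: "?l > 0" using card_common_pos[of N] by simp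
    have "\<rho> ^ defect n w one * x ^ n \<le> (?\<kappa> / ?l) ^ n"
    proof (cases "one \<in> N")
      case True
      have "card (common N) * card N \<noteq> CARD('r)" using card_eq True False by blast
      then have "card (common N) * card N + 1 \<le> CARD('r)" using card_le[of N] by linarith
      then have "real (card (common N) * card N + 1) \<le> ?q" by (simp only: of_nat_le_iff)
      then have "?l * card N \<le> ?q - 1" by simp
      then have "?l * x \<le> (?q - 1) / ?q" unfolding x_def by (simp add: divide_right_mono)
      also have "\<dots> = 1 - 1 / ?q" by (simp add: field_simps)
      also have "\<dots> \<le> ?\<kappa>" using kappa0 by simp
      finally have xl: "x \<le> ?\<kappa> / ?l" using l0 by (simp add: field_simps)
      have "\<rho> ^ defect n w one * x ^ n \<le> 1 * x ^ n"
        using rho_le1 x by (intro mult_right_mono) (auto simp: x_def)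
      also have "\<dots> \<le> (?\<kappa> / ?l) ^ n"
        using xl by (simp add: power_mono x_def)
      finally show ?thesis .
    next
      case False
      have "real (card (common N) * card N) \<le> ?q" using card_le[of N] by (simp only: of_nat_le_iff)
      then have "?l * card N \<le> ?q" by simp
      then have lx: "?l * x \<le> 1" unfolding x_def by (simp add: divide_le_eq_1)
      have "\<rho> ^ defect n w one * x ^ n \<le> ?y ^ n * x ^ n"
        using big[OF False] by (intro mult_right_mono) (auto simp: x_def)
      also have "\<dots> = (?y * x) ^ n" by (simp add: power_mult_distrib)
      also have "\<dots> \<le> (?\<kappa> / ?l) ^ n"
      proof (rule power_mono)
        have "?y * (?l * x) \<le> ?\<kappa> * 1" using lx y \<kappa> l0 by (intro mult_mono) (auto simp: x_def)
        then show "?y * x \<le> ?\<kappa> / ?l" using l0 by (simp add: field_simps)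
      qed (use y in \<open>auto simp: x_def\<close>)
      finally show ?thesis .
    qed
    then have "?C2 * (\<rho> ^ defect n w one * x ^ n) \<le> ?C2 * (?\<kappa> / ?l) ^ n"
      using C by (intro mult_left_mono)
    also have "\<dots> \<le> (?C1 + ?C2) * (?\<kappa> / ?l) ^ n"
      using C \<kappa> l0 by (intro mult_right_mono) auto
    finally have "?C2 * (\<rho> ^ defect n w one * x ^ n) \<le> (?C1 + ?C2) * (?\<kappa> / ?l) ^ n" .
    moreover have "weight n m w \<le> \<rho> ^ defect n w one * (?C2 * x ^ n)"
      unfolding weight_def using A rho_le1 by (intro mult_left_mono) auto
    ultimately show ?thesis by (simp add: mult_ac)
  qed
qed

text \<open>
  The hypothesis that the same multipliers are small on the scales \<open>\<delta>\<close> and \<open>\<delta>'\<close> separates the two roles: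
  the smaller scale \<open>\<delta>\<close> limits the number of words, while all other multipliers have defect
  above the larger scale \<open>\<delta>'\<close>, which makes their terms negligible.
\<close>

lemma class_sum_bound:
  assumes t: "0 < t" "t \<le> 1" and \<delta>: "0 < \<delta>" and \<delta>': "0 < \<delta>'" and m: "int m = int n + u"
    and rate: "t powr (- (real CARD('r) * \<delta>)) * (1 + t * real (card G)) * max \<kappa>\<^sub>0 (\<rho> powr \<delta>') \<le> \<eta>"
  shows "(\<Sum>w\<in>{w \<in> words n. small_set n w \<delta> = N \<and> small_set n w \<delta>' = N}. weight n m w) \<le>
     ((1 / \<kappa>\<^sub>0) ^ nat \<bar>u\<bar> + real CARD('r) ^ nat \<bar>u\<bar> *
        exp (real CARD('r) * (1 / (1 - \<rho> powr \<delta>') + real_of_int \<bar>u\<bar>))) * \<eta> ^ n"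
    (is "sum _ ?S \<le> ?C * _")
proof -
  let ?q = "real CARD('r)" and ?l = "real (card (common N))" and ?\<kappa> = "max \<kappa>\<^sub>0 (\<rho> powr \<delta>')"
  let ?T = "{w \<in> PiE {..<n} (\<lambda>_. G). real (card {i \<in> {..<n}. w i \<notin> common N}) \<le> ?q * (\<delta> * n)}"
  have C: "0 \<le> ?C" using kappa0 by simp
  have \<kappa>: "0 \<le> ?\<kappa>" using kappa0 by simp
  have l1: "?l \<ge> 1" using card_common_pos[of N] by (simp add: Suc_le_eq)
  have "?S \<subseteq> ?T"
  proof
    fix w assume w: "w \<in> ?S"
    then have wG: "w \<in> PiE {..<n} (\<lambda>_. G)" and N: "small_set n w \<delta> = N" by auto
    have "{i \<in> {..<n}. w i \<notin> common N} \<subseteq> (\<Union>r\<in>N. {i \<in> {..<n}. w i \<notin> Z r})"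
      using wG by auto
    then have "card {i \<in> {..<n}. w i \<notin> common N} \<le> card (\<Union>r\<in>N. {i \<in> {..<n}. w i \<notin> Z r})"
      by (intro card_mono) auto
    also have "\<dots> \<le> (\<Sum>r\<in>N. defect n w r)"
      unfolding defect_def by (rule card_UN_le) simp
    finally have "real (card {i \<in> {..<n}. w i \<notin> common N}) \<le> (\<Sum>r\<in>N. real (defect n w r))"
      by (simp only: of_nat_sum[symmetric] of_nat_le_iff)
    also have "\<dots> \<le> (\<Sum>r\<in>N. \<delta> * n)"
      using N by (intro sum_mono) (auto simp: small_set_def)
    also have "\<dots> = real (card N) * (\<delta> * n)" by simp
    also have "\<dots> \<le> ?q * (\<delta> * n)"
      using \<delta> by (intro mult_right_mono) (auto simp: card_mono)
    finally show "w \<in> ?T" using wG by simp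
  qed
  moreover have finT: "finite ?T" using finite_G by (simp add: finite_PiE)
  ultimately have cST: "real (card ?S) \<le> real (card ?T)" by (simp add: card_mono)
  also have "\<dots> \<le> t powr (- (?q * (\<delta> * n))) * (?l + t * card G) ^ n"
    by (rule card_few_exceptions_le) (use finite_G t in auto)
  also have "\<dots> = (t powr (- (?q * \<delta>))) ^ n * (?l + t * card G) ^ n"
    using t by (simp add: powr_realpow[symmetric] powr_powr mult_ac)
  also have "\<dots> \<le> (t powr (- (?q * \<delta>))) ^ n * (?l * (1 + t * card G)) ^ n"
  proof (intro mult_left_mono power_mono)
    have "1 * (t * card G) \<le> ?l * (t * card G)" using l1 t by (intro mult_right_mono) auto
    then show "?l + t * card G \<le> ?l * (1 + t * card G)" by (simp add: distrib_left)
  qed (use t in auto)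
  finally have card_S: "real (card ?S) \<le> (t powr (- (?q * \<delta>))) ^ n * (?l * (1 + t * card G)) ^ n" .
  have "(\<Sum>w\<in>?S. weight n m w) \<le> (\<Sum>w\<in>?S. ?C * (?\<kappa> / ?l) ^ n)"
    by (intro sum_mono weight_bound \<delta>' m) auto
  also have "\<dots> = real (card ?S) * (?C * (?\<kappa> / ?l) ^ n)" by simp
  also have "\<dots> \<le> ((t powr (- (?q * \<delta>))) ^ n * (?l * (1 + t * card G)) ^ n) * (?C * (?\<kappa> / ?l) ^ n)"
    using C \<kappa> l1 by (intro mult_right_mono card_S) auto
  also have "\<dots> = ?C * (t powr (- (?q * \<delta>)) * (1 + t * card G) * ?\<kappa>) ^ n"
    using l1 by (simp add: power_mult_distrib power_divide)
  also have "\<dots> \<le> ?C * \<eta> ^ n"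
    using rate C t \<kappa> by (intro mult_left_mono power_mono mult_nonneg_nonneg) auto
  finally show ?thesis .
qed

text \<open>
  The scales \<open>s 0 \<ge> s 1 \<ge> \<dots>\<close> are chosen one after the other, each so small that the number of words on
  it is beaten by the gain on the previous one. For every word, two consecutive ones among the
  first \<open>CARD('r) + 1\<close> have the same small multipliers.
\<close>

theorem sum_weight_exponentially_small:
  "\<exists>\<theta>. 0 < \<theta> \<and> \<theta> < 1 \<and>
    (\<forall>u::int. \<exists>C. \<forall>n m. int m = int n + u \<longrightarrow> (\<Sum>w\<in>words n. weight n m w) \<le> C * \<theta> ^ n)"
proof -
  let ?q = "real CARD('r)" and ?g = "real (card G)"
  let ?\<kappa> = "\<lambda>\<delta>'. max \<kappa>\<^sub>0 (\<rho> powr \<delta>')"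
  have g: "0 < ?g" using finite_G e_in by (auto simp: card_gt_0_iff)
  have kap: "0 < ?\<kappa> \<delta>'" "?\<kappa> \<delta>' < 1" if "0 < \<delta>'" for \<delta>'
    using kappa0 rho that powr_less_one_pos by (auto simp: less_max_iff_disj)
  have ex: "\<forall>\<delta>'. \<exists>p. 0 < \<delta>' \<longrightarrow> 0 < fst p \<and> fst p \<le> \<delta>' \<and> 0 < snd p \<and> snd p \<le> 1 \<and>
      snd p powr (- (?q * fst p)) * (1 + snd p * ?g) * ?\<kappa> \<delta>' \<le> sqrt (?\<kappa> \<delta>')"
  proof
    fix \<delta>' :: real
    show "\<exists>p. 0 < \<delta>' \<longrightarrow> 0 < fst p \<and> fst p \<le> \<delta>' \<and> 0 < snd p \<and> snd p \<le> 1 \<and>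
      snd p powr (- (?q * fst p)) * (1 + snd p * ?g) * ?\<kappa> \<delta>' \<le> sqrt (?\<kappa> \<delta>')"
    proof (cases "0 < \<delta>'")
      case True
      obtain \<delta> t where "0 < \<delta> \<and> \<delta> \<le> \<delta>' \<and> 0 < t \<and> t \<le> 1 \<and>
          t powr (- (?q * \<delta>)) * (1 + t * ?g) * ?\<kappa> \<delta>' \<le> sqrt (?\<kappa> \<delta>')"
        using small_growth_rate[OF kap[OF True] g, of ?q \<delta>'] True q_ge_1 by auto
      then show ?thesis by (intro exI[of _ "(\<delta>, t)"]) simp
    qed simp
  qed
  obtain p where p: "\<And>\<delta>'. 0 < \<delta>' \<Longrightarrow> 0 < fst (p \<delta>') \<and> fst (p \<delta>') \<le> \<delta>' \<and> 0 < snd (p \<delta>') \<and>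
      snd (p \<delta>') \<le> 1 \<and> snd (p \<delta>') powr (- (?q * fst (p \<delta>'))) * (1 + snd (p \<delta>') * ?g) * ?\<kappa> \<delta>' \<le> sqrt (?\<kappa> \<delta>')"
    using choice[OF ex] by blast
  define s where "s k = ((\<lambda>\<delta>. fst (p \<delta>)) ^^ k) 1" for k
  have s_Suc: "s (Suc k) = fst (p (s k))" for k by (simp add: s_def)
  have s_pos: "0 < s k" for k
    by (induction k) (use p in \<open>auto simp: s_Suc\<close>, simp add: s_def)
  have s_dec: "s (Suc k) \<le> s k" for k using p[OF s_pos[of k]] by (simp add: s_Suc)
  define \<theta> where "\<theta> = Max ((\<lambda>k. sqrt (?\<kappa> (s k))) ` {..<CARD('r)})"
  have q0: "{..<CARD('r)} \<noteq> {}" by (auto simp: lessThan_empty_iff)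
  have "\<theta> \<in> (\<lambda>k. sqrt (?\<kappa> (s k))) ` {..<CARD('r)}"
    unfolding \<theta>_def using q0 by (intro Max_in) auto
  then obtain k0 where "\<theta> = sqrt (?\<kappa> (s k0))" by blast
  then have \<theta>: "0 < \<theta>" "\<theta> < 1" using kap[OF s_pos[of k0]] by auto
  have \<theta>_ge: "sqrt (?\<kappa> (s k)) \<le> \<theta>" if "k < CARD('r)" for k
    unfolding \<theta>_def using that by (intro Max_ge) auto
  have "\<exists>C. \<forall>n m. int m = int n + u \<longrightarrow> (\<Sum>w\<in>words n. weight n m w) \<le> C * \<theta> ^ n" for u :: int
  proof -
    define c where "c k = (1 / \<kappa>\<^sub>0) ^ nat \<bar>u\<bar> + ?q ^ nat \<bar>u\<bar> *
        exp (?q * (1 / (1 - \<rho> powr s k) + real_of_int \<bar>u\<bar>))" for k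
    define C where "C = (\<Sum>k<CARD('r). \<Sum>N\<in>(UNIV :: 'r set set). c k)"
    have "(\<Sum>w\<in>words n. weight n m w) \<le> C * \<theta> ^ n" if m: "int m = int n + u" for n m
    proof -
      let ?S = "\<lambda>k N. {w \<in> words n. small_set n w (s (Suc k)) = N \<and> small_set n w (s k) = N}"
      have finW: "finite (words n)" using finite_G by (simp add: finite_PiE)
      have "words n \<subseteq> (\<Union>k\<in>{..<CARD('r)}. \<Union>N\<in>UNIV. ?S k N)"
      proof
        fix w assume w: "w \<in> words n"
        have "small_set n w (s (Suc k)) \<subseteq> small_set n w (s k)" for k
          unfolding small_set_def using s_dec[of k] mult_right_mono[OF s_dec[of k], of "real n"]
          by (auto intro: order_trans)
        moreover have "small_set n w (s k) \<noteq> {}" for k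
          using zero_small[of w n "s k"] w s_pos[of k] by (auto simp: less_imp_le)
        ultimately obtain k where "k < CARD('r)" "small_set n w (s (Suc k)) = small_set n w (s k)"
          using decreasing_sets_repeat[of "\<lambda>k. small_set n w (s k)"] by blast
        then show "w \<in> (\<Union>k\<in>{..<CARD('r)}. \<Union>N\<in>UNIV. ?S k N)" using w by auto
      qed
      then have "(\<Sum>w\<in>words n. weight n m w) \<le> (\<Sum>w\<in>(\<Union>k\<in>{..<CARD('r)}. \<Union>N\<in>UNIV. ?S k N). weight n m w)"
        using finW by (intro sum_mono2 weight_nonneg) auto
      also have "\<dots> \<le> (\<Sum>k<CARD('r). \<Sum>w\<in>(\<Union>N\<in>UNIV. ?S k N). weight n m w)"
        using finW by (intro sum_UN_le_sum_sum weight_nonneg) auto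
      also have "\<dots> \<le> (\<Sum>k<CARD('r). \<Sum>N\<in>UNIV. \<Sum>w\<in>?S k N. weight n m w)"
        using finW by (intro sum_mono sum_UN_le_sum_sum weight_nonneg) auto
      also have "\<dots> \<le> (\<Sum>k<CARD('r). \<Sum>N\<in>(UNIV :: 'r set set). c k * \<theta> ^ n)"
      proof (intro sum_mono)
        fix k and N :: "'r set" assume k: "k \<in> {..<CARD('r)}"
        show "(\<Sum>w\<in>?S k N. weight n m w) \<le> c k * \<theta> ^ n"
          unfolding c_def
        proof (rule class_sum_bound[where t = "snd (p (s k))"])
          show "snd (p (s k)) powr (- (?q * s (Suc k))) * (1 + snd (p (s k)) * ?g) * ?\<kappa> (s k) \<le> \<theta>"
            using p[OF s_pos[of k]] \<theta>_ge[of k] k unfolding s_Suc by fastforce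
        qed (use p[OF s_pos[of k]] s_pos m in auto)
      qed
      also have "\<dots> = C * \<theta> ^ n" unfolding C_def by (simp only: sum_distrib_right)
      finally show ?thesis .
    qed
    then show ?thesis by blast
  qed
  then show ?thesis using \<theta> by blast
qed

end

section \<open>Exponential decay of the mean distance\<close>

lemma prod_norm_char_mean_le:
  fixes \<mu> :: "'a::{finite,comm_ring_1} pmf"
  assumes gap: "\<And>i f. f \<in> chars \<Longrightarrow>
      norm (char_mean (law i) f) \<le> (if f \<in> const_chars \<mu> then 1 else \<rho>)"
    and w: "w \<in> char_vecs n"
  shows "(\<Prod>i<n. norm (char_mean (law i) (\<lambda>x. w i (r * x)))) \<le>
           \<rho> ^ card {i \<in> {..<n}. (\<lambda>x. w i (r * x)) \<notin> const_chars \<mu>}"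
proof -
  have "(\<Prod>i<n. norm (char_mean (law i) (\<lambda>x. w i (r * x)))) \<le>
      (\<Prod>i<n. if (\<lambda>x. w i (r * x)) \<in> const_chars \<mu> then 1 else \<rho>)"
    using w by (intro prod_mono conjI gap chars_scale) (auto intro: char_vecs_nth)
  also have "{..<n} \<inter> - {i. (\<lambda>x. w i (r * x)) \<in> const_chars \<mu>} =
      {i \<in> {..<n}. (\<lambda>x. w i (r * x)) \<notin> const_chars \<mu>}" by auto
  then have "(\<Prod>i<n. if (\<lambda>x. w i (r * x)) \<in> const_chars \<mu> then 1 else \<rho>) =
      \<rho> ^ card {i \<in> {..<n}. (\<lambda>x. w i (r * x)) \<notin> const_chars \<mu>}"
    by (simp add: prod.If_cases)
  finally show ?thesis .
qed

lemma tv_dist_nonneg: "0 \<le> tv_dist p q"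
proof -
  have "bdd_above (range (\<lambda>A. \<bar>measure_pmf.prob p A - measure_pmf.prob q A\<bar>))"
  proof (rule bdd_aboveI2)
    fix A
    have "0 \<le> measure_pmf.prob p A" "measure_pmf.prob p A \<le> 1"
      "0 \<le> measure_pmf.prob q A" "measure_pmf.prob q A \<le> 1" by simp_all
    then show "\<bar>measure_pmf.prob p A - measure_pmf.prob q A\<bar> \<le> 1" by linarith
  qed
  then have "\<bar>measure_pmf.prob p {} - measure_pmf.prob q {}\<bar> \<le> tv_dist p q"
    unfolding tv_dist_def by (intro cSUP_upper) auto
  then show ?thesis by simp
qed

lemma mean_tv_nonneg: "0 \<le> mean_tv n m \<mu> E"
  unfolding mean_tv_def by (intro sum_nonneg mult_nonneg_nonneg tv_dist_nonneg) simp

text \<open>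
  The Fourier bound, with each expectation of a nonconstant character replaced by \<open>\<rho>\<close> and each other
  one by 1, is the total weight in a \<open>defect_system\<close>, and \<open>stable_chars_card\<close> supplies its
  assumptions. The resulting bound is the same for all sets \<open>E\<close>.
\<close>

lemma mean_tv_exponentially_small:
  fixes \<mu> :: "'a::{finite, comm_ring_1} pmf"
  assumes "local_ring TYPE('a)" "not_on_ideal_translate \<mu>" "not_on_subring_translate \<mu>"
  shows "\<exists>\<theta>. 0 < \<theta> \<and> \<theta> < 1 \<and>
    (\<forall>u::int. \<exists>C. \<forall>n m E. int m = int n + u \<longrightarrow> mean_tv n m \<mu> E \<le> C * \<theta> ^ n)"
proof -
  obtain \<rho> where \<rho>: "0 < \<rho>" "\<rho> < 1"
    and gap: "\<And>E ij f. f \<in> chars \<Longrightarrow>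
      norm (char_mean (entry_law \<mu> E ij) f) \<le> (if f \<in> const_chars \<mu> then 1 else \<rho>)"
    using uniform_char_mean_gap[of \<mu>] by blast
  define Z where "Z = (\<lambda>r. {f. (\<lambda>x. f (r * x)) \<in> const_chars \<mu>})"
  have common: "{f \<in> chars. \<forall>r\<in>N. f \<in> Z r} = stable_chars \<mu> N" for N
    by (auto simp: Z_def stable_chars_def)
  interpret D: defect_system chars Z "\<lambda>_. 1" "1 :: 'a" 0 \<rho>
  proof
    show "finite (chars :: ('a \<Rightarrow> complex) set)" by (rule finite_chars)
    show "(\<lambda>_. 1) \<in> Z r" for r by (simp add: Z_def const_chars_def)
    show "chars \<subseteq> Z 0" by (auto simp: Z_def const_chars_def chars_zero)
    show "card {f \<in> chars. \<forall>r\<in>N. f \<in> Z r} * card N \<le> CARD('a)" for N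
      unfolding common by (rule stable_chars_card(1)[OF assms])
    show "N = UNIV" if "card {f \<in> chars. \<forall>r\<in>N. f \<in> Z r} * card N = CARD('a)" "1 \<in> N" for N
      using that unfolding common by (rule stable_chars_card(2)[OF assms])
  qed (use \<rho> in auto)
  have bound: "mean_tv n m \<mu> E \<le> (\<Sum>w\<in>D.words n. D.weight n m w)" for n m E
  proof -
    let ?g = "\<lambda>w. \<Prod>i<n. norm (char_mean \<mu> (w i))"
    let ?h = "\<lambda>w. \<Prod>j<m. (\<Sum>r\<in>UNIV. \<Prod>i<n.
        norm (char_mean (entry_law \<mu> E (i, j)) (\<lambda>x. w i (r * x)))) / real CARD('a)"
    have words: "D.words n = char_vecs n - {trivial_char_vec n}"
      by (simp add: char_vecs_def trivial_char_vec_def)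
    have defect: "D.defect n w r = card {i \<in> {..<n}. (\<lambda>x. w i (r * x)) \<notin> const_chars \<mu>}" for w r
      unfolding D.defect_def by (simp add: Z_def)
    have "?g w * ?h w \<le> D.weight n m w" if "w \<in> D.words n" for w
    proof -
      have w: "w \<in> char_vecs n" using that words by blast
      have "?g w \<le> \<rho> ^ D.defect n w 1"
        using prod_norm_char_mean_le[of "\<lambda>_. \<mu>" \<mu> \<rho> w n 1] gap[of _ "{}"] w
        by (simp add: entry_law_def defect)
      moreover have "?h w \<le> (\<Prod>j<m. (\<Sum>r\<in>UNIV. \<rho> ^ D.defect n w r) / real CARD('a))"
        unfolding defect
        by (intro prod_mono conjI divide_right_mono sum_mono prod_norm_char_mean_le[OF gap w]
              divide_nonneg_nonneg sum_nonneg prod_nonneg) auto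
      ultimately have "?g w * ?h w \<le>
          \<rho> ^ D.defect n w 1 * (\<Prod>j<m. (\<Sum>r\<in>UNIV. \<rho> ^ D.defect n w r) / real CARD('a))"
        using \<rho> by (intro mult_mono prod_nonneg) (auto intro!: divide_nonneg_nonneg sum_nonneg prod_nonneg)
      then show ?thesis unfolding D.weight_def by simp
    qed
    then have "(\<Sum>w\<in>D.words n. ?g w * ?h w) \<le> (\<Sum>w\<in>D.words n. D.weight n m w)"
      by (rule sum_mono)
    then show ?thesis using mean_tv_le[of n m \<mu> E] unfolding words by linarith
  qed
  obtain \<theta> where \<theta>: "0 < \<theta>" "\<theta> < 1"
    and small: "\<And>u::int. \<exists>C. \<forall>n m. int m = int n + u \<longrightarrow> (\<Sum>w\<in>D.words n. D.weight n m w) \<le> C * \<theta> ^ n"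
    using D.sum_weight_exponentially_small by blast
  have "\<exists>C. \<forall>n m E. int m = int n + u \<longrightarrow> mean_tv n m \<mu> E \<le> C * \<theta> ^ n" for u :: int
    using small[of u] bound by (meson order_trans)
  then show ?thesis using \<theta> by blast
qed

theorem theorem2p1:
  fixes \<mu> :: "'a::{finite, comm_ring_1} pmf"
  assumes "local_ring TYPE('a)"
    and "not_on_ideal_translate \<mu>"
    and "not_on_subring_translate \<mu>"
  shows "\<exists>\<theta>::real. 0 < \<theta> \<and> \<theta> < 1 \<and>
    (\<forall>u::int.
      (\<lambda>n. mean_tv n (nat (int n + u)) \<mu> {}) \<in> O(\<lambda>n. \<theta> ^ n) \<and>
      (\<exists>C. \<forall>n E. n \<ge> 1 \<and> int n + u \<ge> 1 \<and> E \<subseteq> {..<n} \<times> {..<nat (int n + u)} \<longrightarrow>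
         mean_tv n (nat (int n + u)) \<mu> E \<le> C * \<theta> ^ n))"
proof -
  obtain \<theta> where \<theta>: "0 < \<theta>" "\<theta> < 1"
    and small: "\<And>u::int. \<exists>C. \<forall>n m E. int m = int n + u \<longrightarrow> mean_tv n m \<mu> E \<le> C * \<theta> ^ n"
    using mean_tv_exponentially_small[OF assms] by blast
  show ?thesis
  proof (rule exI[of _ \<theta>], intro conjI allI \<theta>)
    fix u :: int
    obtain C where C: "\<And>n m E. int m = int n + u \<Longrightarrow> mean_tv n m \<mu> E \<le> C * \<theta> ^ n"
      using small[of u] by blast
    show "(\<lambda>n. mean_tv n (nat (int n + u)) \<mu> {}) \<in> O(\<lambda>n. \<theta> ^ n)"
    proof (rule bigoI)
      show "eventually (\<lambda>n. norm (mean_tv n (nat (int n + u)) \<mu> {}) \<le> C * norm (\<theta> ^ n)) at_top"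
        using eventually_ge_at_top[of "nat \<bar>u\<bar>"]
      proof eventually_elim
        case (elim n)
        then have "int (nat (int n + u)) = int n + u" by linarith
        then show ?case using C mean_tv_nonneg[of n _ \<mu> "{}"] \<theta> by simp
      qed
    qed
    show "\<exists>C. \<forall>n E. n \<ge> 1 \<and> int n + u \<ge> 1 \<and> E \<subseteq> {..<n} \<times> {..<nat (int n + u)} \<longrightarrow>
         mean_tv n (nat (int n + u)) \<mu> E \<le> C * \<theta> ^ n"
      using C by (intro exI[of _ C]) auto
  qed
qed

end
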